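(* Let $K=\mathbb{R}P^2\sharp\mathbb{R}P^2$ be a Klein bottle. Then there exists an embedding $f:K\to\mathbb{R}^4$ with Euler normal number $e(\nu)=0$ and $\mathcal{W}(f)<8\pi$.
   Context: $\mathcal{W}(f)=\frac14\int|H|^2\,d\mu_g$ is the Willmore energy. Euler normal number: with a positively oriented orthonormal frame $\{E_1,E_2,N_1,N_2\}$ of $\mathbb{R}^4$ ($E_i$ tangent, $N_i$ normal) let $K^\perp=\langle R^\perp(E_1,E_2)N_2,N_1\rangle$ ($R^\perp$ the normal curvature) and $e(\nu)=\frac1{2\pi}\int_K K^\perp\,d\mu_g$. *)

theory Defs
  imports "HOL-Analysis.Analysis"
begin

text \<open>Surfaces are described by smooth maps f from the parameter plane (u,v) to R^4.
  The Klein bottle K is the quotient of R^2 by the group generated by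
  a(u,v) = (u+1,-v) and b(u,v) = (u,v+1); [0,1]x[0,1] is a fundamental domain.\<close>

definition e_u :: "real \<times> real" where "e_u = (1, 0)"
definition e_v :: "real \<times> real" where "e_v = (0, 1)"

definition pd :: "real \<times> real \<Rightarrow> (real \<times> real \<Rightarrow> 'a::real_normed_vector) \<Rightarrow> real \<times> real \<Rightarrow> 'a" where
  "pd e g p = vector_derivative (\<lambda>t. g (p + t *\<^sub>R e)) (at 0)"

definition iter_pd :: "(real \<times> real) list \<Rightarrow> (real \<times> real \<Rightarrow> 'a::real_normed_vector) \<Rightarrow> real \<times> real \<Rightarrow> 'a" where
  "iter_pd ds g = foldr pd ds g"

definition smooth_on2 :: "(real \<times> real) set \<Rightarrow> (real \<times> real \<Rightarrow> 'a::real_normed_vector) \<Rightarrow> bool" where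
  "smooth_on2 U g \<longleftrightarrow> (\<forall>ds. set ds \<subseteq> {e_u, e_v} \<longrightarrow>
      continuous_on U (iter_pd ds g) \<and>
      (\<forall>q\<in>U. \<forall>e\<in>{e_u, e_v}. (\<lambda>t. iter_pd ds g (q + t *\<^sub>R e)) differentiable (at 0)))"

definition gE :: "(real \<times> real \<Rightarrow> real^4) \<Rightarrow> real \<times> real \<Rightarrow> real" where
  "gE f p = pd e_u f p \<bullet> pd e_u f p"
definition gF :: "(real \<times> real \<Rightarrow> real^4) \<Rightarrow> real \<times> real \<Rightarrow> real" where
  "gF f p = pd e_u f p \<bullet> pd e_v f p"
definition gG :: "(real \<times> real \<Rightarrow> real^4) \<Rightarrow> real \<times> real \<Rightarrow> real" where
  "gG f p = pd e_v f p \<bullet> pd e_v f p"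
definition gD :: "(real \<times> real \<Rightarrow> real^4) \<Rightarrow> real \<times> real \<Rightarrow> real" where
  "gD f p = gE f p * gG f p - (gF f p)\<^sup>2"

definition nproj :: "(real \<times> real \<Rightarrow> real^4) \<Rightarrow> real \<times> real \<Rightarrow> real^4 \<Rightarrow> real^4" where
  "nproj f p x = x
     - ((gG f p * (x \<bullet> pd e_u f p) - gF f p * (x \<bullet> pd e_v f p)) / gD f p) *\<^sub>R pd e_u f p
     - ((gE f p * (x \<bullet> pd e_v f p) - gF f p * (x \<bullet> pd e_u f p)) / gD f p) *\<^sub>R pd e_v f p"

text \<open>Mean curvature vector H = trace_g of the second fundamental form h_ij = (d_i d_j f)^perp.\<close>
definition mean_curv :: "(real \<times> real \<Rightarrow> real^4) \<Rightarrow> real \<times> real \<Rightarrow> real^4" where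
  "mean_curv f p = nproj f p
     ((1 / gD f p) *\<^sub>R (gG f p *\<^sub>R pd e_u (pd e_u f) p
                       - (2 * gF f p) *\<^sub>R pd e_u (pd e_v f) p
                       + gE f p *\<^sub>R pd e_v (pd e_v f) p))"

definition willmore :: "(real \<times> real \<Rightarrow> real^4) \<Rightarrow> real" where
  "willmore f = 1/4 * integral (cbox (0,0) (1,1)) (\<lambda>p. (norm (mean_curv f p))\<^sup>2 * sqrt (gD f p))"

definition det4 :: "real^4 \<Rightarrow> real^4 \<Rightarrow> real^4 \<Rightarrow> real^4 \<Rightarrow> real" where
  "det4 a b c d = det ((\<chi> i. if i = 1 then a else if i = 2 then b else if i = 3 then c else d) :: real^4^4)"

definition nabla_perp :: "(real \<times> real \<Rightarrow> real^4) \<Rightarrow> real \<times> real \<Rightarrow> (real \<times> real \<Rightarrow> real^4) \<Rightarrow> real \<times> real \<Rightarrow> real^4" where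
  "nabla_perp f e N q = nproj f q (pd e N q)"

text \<open>Normal curvature R^perp(d_u, d_v) N (coordinate fields commute).\<close>
definition R_perp :: "(real \<times> real \<Rightarrow> real^4) \<Rightarrow> (real \<times> real \<Rightarrow> real^4) \<Rightarrow> real \<times> real \<Rightarrow> real^4" where
  "R_perp f N p = nabla_perp f e_u (nabla_perp f e_v N) p - nabla_perp f e_v (nabla_perp f e_u N) p"

definition normal_frame :: "(real \<times> real \<Rightarrow> real^4) \<Rightarrow> (real \<times> real) set \<Rightarrow> (real \<times> real \<Rightarrow> real^4) \<Rightarrow> (real \<times> real \<Rightarrow> real^4) \<Rightarrow> bool" where
  "normal_frame f U N1 N2 \<longleftrightarrow> open U \<and> smooth_on2 U N1 \<and> smooth_on2 U N2 \<and>
     (\<forall>q\<in>U. norm (N1 q) = 1 \<and> norm (N2 q) = 1 \<and> N1 q \<bullet> N2 q = 0 \<and>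
        N1 q \<bullet> pd e_u f q = 0 \<and> N1 q \<bullet> pd e_v f q = 0 \<and>
        N2 q \<bullet> pd e_u f q = 0 \<and> N2 q \<bullet> pd e_v f q = 0 \<and>
        det4 (pd e_u f q) (pd e_v f q) (N1 q) (N2 q) > 0)"

text \<open>K^perp = <R^perp(E1,E2)N2, N1> for a positively oriented orthonormal frame
  {E1,E2,N1,N2}; with E1 \<and> E2 = (f_u \<and> f_v)/sqrt D this is <R^perp(d_u,d_v)N2,N1>/sqrt D
  (independent of the choice of local frame).\<close>
definition K_perp :: "(real \<times> real \<Rightarrow> real^4) \<Rightarrow> real \<times> real \<Rightarrow> real" where
  "K_perp f p = (SOME k. \<exists>U N1 N2. normal_frame f U N1 N2 \<and> p \<in> U \<and>
                     k = (R_perp f N2 p \<bullet> N1 p) / sqrt (gD f p))"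

definition euler_normal :: "(real \<times> real \<Rightarrow> real^4) \<Rightarrow> real" where
  "euler_normal f = 1 / (2 * pi) * integral (cbox (0,0) (1,1)) (\<lambda>p. K_perp f p * sqrt (gD f p))"

text \<open>f (as a map on R^2) descends to a smooth embedding of the Klein bottle
  K = R^2 / <a,b> into R^4: smooth, invariant under the deck group, immersive,
  and injective modulo the group action (orbit of (u,v) = {(u+m, (-1)^m (v+n))}).\<close>
definition klein_embedding :: "(real \<times> real \<Rightarrow> real^4) \<Rightarrow> bool" where
  "klein_embedding f \<longleftrightarrow> smooth_on2 UNIV f \<and>
     (\<forall>u v. f (u + 1, - v) = f (u, v) \<and> f (u, v + 1) = f (u, v)) \<and>
     (\<forall>p. pd e_u f p \<noteq> pd e_v f p \<and> independent {pd e_u f p, pd e_v f p}) \<and>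
     (\<forall>p q. f p = f q \<longrightarrow>
        (\<exists>m n :: int. q = (fst p + of_int m, (-1) ^ nat \<bar>m\<bar> * (snd p + of_int n))))"

end

theory Submission
  imports Defs
begin

text \<open>Rotate a circle about the point (0, 3/2) of the (Re z, Re w)-plane in C^2 by the action
  (e^{i s} z, e^{2 i s} w). The half turn s = pi maps z to -z, so the orbit closes up to a Klein bottle.
  By the rotational symmetry the Willmore integrand depends on one parameter only; it has the form
  Q^2 / X^{3/2} with Q and X quadratic polynomials in the cosine c of the profile angle, and a quadratic
  majorant in c already keeps the energy below 8 pi. Pulled back to the parameter plane, the normal bundle has an oriented frame
  equivariant under rotation, and its connection form is periodic in the profile parameter, so the normal
  curvature integrates to 0.\<close>

section \<open>Iterated partial derivatives\<close>

text \<open>\<open>K_perp\<close> is a \<open>SOME\<close> over all local oriented normal frames, so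
  nothing can be computed before the value is known to be frame independent. The Ricci equation
  supplies this: it involves the frame only through its value at the point, where two admissible
  frames differ by a rotation. A competing frame is smooth only in the sense of iterated partials,
  so the symmetry of mixed partials is proved in that setting. The map is injective modulo the deck
  group because the centre height 3/2 exceeds the profile radius 1: w never vanishes, its argument
  fixes u modulo 1, and the profile point then fixes v modulo 1 up to the sign (-1)^m, where m is
  the integer shift of u. The reflection of the profile circle under v to -v compensates z to -z. A
  majorant quadratic in c has an integral that is read off from the means of c and c^2, and squaring
  the pointwise bound leaves a polynomial inequality on [-1,1].\<close>

lemma smooth_on2_has_vector_derivative:
  assumes "smooth_on2 U g" "q \<in> U" "e \<in> {e_u, e_v}"
  shows "((\<lambda>t. g (q + t *\<^sub>R e)) has_vector_derivative pd e g q) (at 0)"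
proof -
  have "(\<lambda>t. iter_pd [] g (q + t *\<^sub>R e)) differentiable (at 0)"
    using assms unfolding smooth_on2_def by (metis empty_set empty_subsetI)
  then show ?thesis
    by (simp add: iter_pd_def pd_def vector_derivative_works)
qed

text \<open>\<open>foldr\<close> applies the last direction of the list innermost, so a derivative
  taken beforehand is appended at the end of the list.\<close>

lemma smooth_on2_pd:
  assumes "smooth_on2 U g" "e \<in> {e_u, e_v}"
  shows "smooth_on2 U (pd e g)"
proof -
  have eq: "iter_pd ds (pd e g) = iter_pd (ds @ [e]) g" for ds
    by (simp add: iter_pd_def)
  show ?thesis
    unfolding smooth_on2_def
  proof (intro allI impI)
    fix ds :: "(real \<times> real) list" assume "set ds \<subseteq> {e_u, e_v}"
    then have "set (ds @ [e]) \<subseteq> {e_u, e_v}" using assms(2) by auto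
    then show "continuous_on U (iter_pd ds (pd e g)) \<and>
        (\<forall>q\<in>U. \<forall>e'\<in>{e_u, e_v}. (\<lambda>t. iter_pd ds (pd e g) (q + t *\<^sub>R e')) differentiable (at 0))"
      using assms(1) unfolding smooth_on2_def eq by blast
  qed
qed

lemma smooth_on2_continuous_on: "smooth_on2 U g \<Longrightarrow> continuous_on U g"
  unfolding smooth_on2_def iter_pd_def by (metis empty_set empty_subsetI foldr.simps(1) id_apply)

text \<open>A family of continuous functions closed under both partials contains all iterated
  partials of its members. Smoothness thus follows without computing any higher derivative.\<close>

lemma smooth_on2_coinduct:
  assumes "f \<in> S"
    and cont: "\<And>g. g \<in> S \<Longrightarrow> continuous_on UNIV g"
    and step: "\<And>g e. g \<in> S \<Longrightarrow> e \<in> {e_u, e_v} \<Longrightarrow>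
      \<exists>g'\<in>S. \<forall>q. ((\<lambda>t. g (q + t *\<^sub>R e)) has_vector_derivative g' q) (at 0)"
  shows "smooth_on2 UNIV f"
proof -
  have pdS: "pd e g \<in> S" if gS: "g \<in> S" "e \<in> {e_u, e_v}" for e g
  proof -
    obtain g' where g': "g' \<in> S" "\<And>q. ((\<lambda>t. g (q + t *\<^sub>R e)) has_vector_derivative g' q) (at 0)"
      using step[OF gS] by blast
    have "pd e g = g'"
      unfolding pd_def by (intro ext vector_derivative_at g'(2))
    then show ?thesis using g'(1) by simp
  qed
  have "iter_pd ds f \<in> S" if "set ds \<subseteq> {e_u, e_v}" for ds
    using that by (induction ds) (auto simp: iter_pd_def assms(1) intro: pdS)
  then show ?thesis
    unfolding smooth_on2_def using cont step
    by (meson UNIV_I differentiableI_vector)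
qed

text \<open>Both mixed partials are values of the second difference quotient over a small square,
  by the mean value theorem applied in either order.\<close>
lemma mixed_partials_eq:
  fixes h hx hy hxy hyx :: "real \<Rightarrow> real \<Rightarrow> real"
  assumes r: "r > 0"
    and hx: "\<And>x y. \<bar>x - a\<bar> < r \<Longrightarrow> \<bar>y - b\<bar> < r \<Longrightarrow> ((\<lambda>x. h x y) has_real_derivative hx x y) (at x)"
    and hy: "\<And>x y. \<bar>x - a\<bar> < r \<Longrightarrow> \<bar>y - b\<bar> < r \<Longrightarrow> ((\<lambda>y. h x y) has_real_derivative hy x y) (at y)"
    and hxy: "\<And>x y. \<bar>x - a\<bar> < r \<Longrightarrow> \<bar>y - b\<bar> < r \<Longrightarrow> ((\<lambda>y. hx x y) has_real_derivative hxy x y) (at y)"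
    and hyx: "\<And>x y. \<bar>x - a\<bar> < r \<Longrightarrow> \<bar>y - b\<bar> < r \<Longrightarrow> ((\<lambda>x. hy x y) has_real_derivative hyx x y) (at x)"
    and cxy: "isCont (\<lambda>p. hxy (fst p) (snd p)) (a, b)"
    and cyx: "isCont (\<lambda>p. hyx (fst p) (snd p)) (a, b)"
  shows "hxy a b = hyx a b"
proof (rule ccontr)
  assume ne: "hxy a b \<noteq> hyx a b"
  define d where "d = \<bar>hxy a b - hyx a b\<bar> / 2"
  have d: "d > 0" using ne by (simp add: d_def)
  obtain d1 where d1: "d1 > 0"
    "\<And>p. dist p (a, b) < d1 \<Longrightarrow> dist (hxy (fst p) (snd p)) (hxy a b) < d"
    using cxy d unfolding continuous_at_eps_delta by (metis fst_conv snd_conv)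
  obtain d2 where d2: "d2 > 0"
    "\<And>p. dist p (a, b) < d2 \<Longrightarrow> dist (hyx (fst p) (snd p)) (hyx a b) < d"
    using cyx d unfolding continuous_at_eps_delta by (metis fst_conv snd_conv)
  \<comment> \<open>Points of the square lie within \<open>2 * s\<close> of the corner by the l1
    estimate, and the quarter keeps this below \<open>d1\<close> and \<open>d2\<close>.\<close>
  define s where "s = min r (min d1 d2) / 4"
  have s: "s > 0" "s < r" "2 * s < d1" "2 * s < d2"
    using r d1(1) d2(1) by (auto simp: s_def min_def)
  let ?D = "h (a + s) (b + s) - h (a + s) b - h a (b + s) + h a b"
  have near: "dist (x, y) (a, b) \<le> 2 * s" if "a < x" "x < a + s" "b < y" "y < b + s" for x y
  proof -
    have "dist (x, y) (a, b) \<le> \<bar>x - a\<bar> + \<bar>y - b\<bar>"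
      unfolding dist_Pair_Pair using sqrt_sum_squares_le_sum_abs by (simp add: dist_real_def)
    then show ?thesis using that by simp
  qed
  have "\<exists>x>a. x < a + s \<and> (h (a + s) (b + s) - h (a + s) b) - (h a (b + s) - h a b)
      = (a + s - a) * (hx x (b + s) - hx x b)"
    by (rule MVT2) (use s in \<open>auto intro!: DERIV_diff hx\<close>)
  then obtain x where x: "a < x" "x < a + s" "?D = s * (hx x (b + s) - hx x b)"
    by (auto simp: algebra_simps)
  have "\<exists>y>b. y < b + s \<and> hx x (b + s) - hx x b = (b + s - b) * hxy x y"
    by (rule MVT2) (use s x in \<open>auto intro!: hxy\<close>)
  then obtain y where y: "b < y" "y < b + s" "hx x (b + s) - hx x b = s * hxy x y"
    by auto
  have "\<exists>y'>b. y' < b + s \<and> (h (a + s) (b + s) - h a (b + s)) - (h (a + s) b - h a b)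
      = (b + s - b) * (hy (a + s) y' - hy a y')"
    by (rule MVT2) (use s in \<open>auto intro!: DERIV_diff hy\<close>)
  then obtain y' where y': "b < y'" "y' < b + s" "?D = s * (hy (a + s) y' - hy a y')"
    by (auto simp: algebra_simps)
  have "\<exists>x'>a. x' < a + s \<and> hy (a + s) y' - hy a y' = (a + s - a) * hyx x' y'"
    by (rule MVT2) (use s y' in \<open>auto intro!: hyx\<close>)
  then obtain x' where x': "a < x'" "x' < a + s" "hy (a + s) y' - hy a y' = s * hyx x' y'"
    by auto
  have "hxy x y = hyx x' y'"
    using x(3) y(3) y'(3) x'(3) s(1) by simp
  moreover have "dist (hxy x y) (hxy a b) < d"
    using d1(2)[of "(x, y)"] near[of x y] x y s by simp
  moreover have "dist (hyx x' y') (hyx a b) < d"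
    using d2(2)[of "(x', y')"] near[of x' y'] x' y' s by simp
  ultimately show False
    by (simp add: d_def dist_real_def field_simps abs_if split: if_splits)
qed

lemma pd_commute:
  fixes N :: "real \<times> real \<Rightarrow> 'a::real_inner"
  assumes sm: "smooth_on2 U N" and U: "open U" "p \<in> U"
  shows "pd e_u (pd e_v N) p = pd e_v (pd e_u N) p"
proof -
  obtain a b where p: "p = (a, b)" by force
  obtain A B where AB: "open A" "open B" "p \<in> A \<times> B" "A \<times> B \<subseteq> U"
    using U open_prod_elim by metis
  obtain r1 where r1: "r1 > 0" "\<And>x. \<bar>x - a\<bar> < r1 \<Longrightarrow> x \<in> A"
    using AB p unfolding open_dist dist_real_def by auto
  obtain r2 where r2: "r2 > 0" "\<And>x. \<bar>x - b\<bar> < r2 \<Longrightarrow> x \<in> B"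
    using AB p unfolding open_dist dist_real_def by auto
  define r where "r = min r1 r2"
  have r: "r > 0" "\<And>x y. \<bar>x - a\<bar> < r \<Longrightarrow> \<bar>y - b\<bar> < r \<Longrightarrow> (x, y) \<in> U"
    using r1 r2 AB by (auto simp: r_def)
  \<comment> \<open>Pairing with a fixed vector reduces to real functions; taking the difference
    itself as that vector turns the scalar identity into \<open>w \<bullet> w = 0\<close>.\<close>
  define w where "w = pd e_u (pd e_v N) p - pd e_v (pd e_u N) p"
  have du: "((\<lambda>x. g (x, y) \<bullet> w) has_real_derivative pd e_u g (x, y) \<bullet> w) (at x)"
    if "smooth_on2 U g" "(x, y) \<in> U" for x y and g :: "real \<times> real \<Rightarrow> 'a"
  proof -
    have "((\<lambda>t. g ((x, y) + t *\<^sub>R e_u) \<bullet> w) has_vector_derivative pd e_u g (x, y) \<bullet> w) (at 0)"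
      using smooth_on2_has_vector_derivative[OF that, of e_u]
      by (intro bounded_linear.has_vector_derivative[OF bounded_linear_inner_left]) auto
    then have "((\<lambda>t. g (t + x, y) \<bullet> w) has_real_derivative pd e_u g (x, y) \<bullet> w) (at 0)"
      by (simp add: e_u_def has_real_derivative_iff_has_vector_derivative add.commute)
    then show ?thesis using DERIV_shift[of "\<lambda>x. g (x, y) \<bullet> w" _ 0 x] by simp
  qed
  have dv: "((\<lambda>y. g (x, y) \<bullet> w) has_real_derivative pd e_v g (x, y) \<bullet> w) (at y)"
    if "smooth_on2 U g" "(x, y) \<in> U" for x y and g :: "real \<times> real \<Rightarrow> 'a"
  proof -
    have "((\<lambda>t. g ((x, y) + t *\<^sub>R e_v) \<bullet> w) has_vector_derivative pd e_v g (x, y) \<bullet> w) (at 0)"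
      using smooth_on2_has_vector_derivative[OF that, of e_v]
      by (intro bounded_linear.has_vector_derivative[OF bounded_linear_inner_left]) auto
    then have "((\<lambda>t. g (x, t + y) \<bullet> w) has_real_derivative pd e_v g (x, y) \<bullet> w) (at 0)"
      by (simp add: e_v_def has_real_derivative_iff_has_vector_derivative add.commute)
    then show ?thesis using DERIV_shift[of "\<lambda>y. g (x, y) \<bullet> w" _ 0 y] by simp
  qed
  have ct: "isCont (\<lambda>q. g q \<bullet> w) p" if "smooth_on2 U g" for g :: "real \<times> real \<Rightarrow> 'a"
    using smooth_on2_continuous_on[OF that] U
    by (intro continuous_intros) (simp add: continuous_on_eq_continuous_at)
  note sm' = sm smooth_on2_pd[OF sm, of e_u] smooth_on2_pd[OF sm, of e_v]
  have "pd e_v (pd e_u N) (a, b) \<bullet> w = pd e_u (pd e_v N) (a, b) \<bullet> w"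
    by (rule mixed_partials_eq[where h = "\<lambda>x y. N (x, y) \<bullet> w" and r = r
          and hx = "\<lambda>x y. pd e_u N (x, y) \<bullet> w" and hy = "\<lambda>x y. pd e_v N (x, y) \<bullet> w"])
      (use r sm' ct[OF smooth_on2_pd] in \<open>auto intro!: du dv simp: p\<close>)
  then have "w \<bullet> w = 0"
    by (simp add: w_def p inner_diff_left)
  then show ?thesis by (simp add: w_def)
qed

text \<open>Existence is enough for the Ricci equation, where the values of these derivatives
  disappear.\<close>

lemma first_fundamental_form_differentiable:
  fixes f :: "real \<times> real \<Rightarrow> real^4"
  assumes f: "smooth_on2 UNIV f" and e: "e \<in> {e_u, e_v}"
  shows "\<exists>E'. ((\<lambda>t. gE f (p + t *\<^sub>R e)) has_real_derivative E') (at 0)"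
    and "\<exists>F'. ((\<lambda>t. gF f (p + t *\<^sub>R e)) has_real_derivative F') (at 0)"
    and "\<exists>G'. ((\<lambda>t. gG f (p + t *\<^sub>R e)) has_real_derivative G') (at 0)"
proof -
  note d = smooth_on2_has_vector_derivative[OF smooth_on2_pd[OF f] UNIV_I e]
  have in_d: "\<exists>D. ((\<lambda>t. X t \<bullet> Y t) has_real_derivative D) (at 0)"
    if "(X has_vector_derivative X') (at 0)" "(Y has_vector_derivative Y') (at 0)"
    for X Y :: "real \<Rightarrow> real^4" and X' Y'
    using bounded_bilinear.has_vector_derivative[OF bounded_bilinear_inner that]
    by (auto simp: has_real_derivative_iff_has_vector_derivative)
  show "\<exists>E'. ((\<lambda>t. gE f (p + t *\<^sub>R e)) has_real_derivative E') (at 0)"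
    "\<exists>F'. ((\<lambda>t. gF f (p + t *\<^sub>R e)) has_real_derivative F') (at 0)"
    "\<exists>G'. ((\<lambda>t. gG f (p + t *\<^sub>R e)) has_real_derivative G') (at 0)"
    unfolding gE_def gF_def gG_def by (rule in_d[OF d d]; simp)+
qed

section \<open>Normal curvature\<close>

lemma inner_nproj:
  assumes "pd e_u f p \<bullet> w = 0" "pd e_v f p \<bullet> w = 0"
  shows "nproj f p x \<bullet> w = x \<bullet> w"
  using assms by (simp add: nproj_def inner_diff_left)

text \<open>The product rule for a pairing that vanishes near \<open>p\<close>. For \<open>g\<close>
  a coordinate tangent field it trades derivatives of the normal field for second derivatives of the
  map (Weingarten).\<close>

lemma inner_pd_of_orthogonal:
  fixes N g :: "real \<times> real \<Rightarrow> 'a::real_inner"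
  assumes N: "smooth_on2 U N" and g: "smooth_on2 UNIV g" and U: "open U" "p \<in> U"
    and e: "e \<in> {e_u, e_v}" and 0: "\<And>q. q \<in> U \<Longrightarrow> N q \<bullet> g q = 0"
  shows "pd e N p \<bullet> g p = - (N p \<bullet> pd e g p)"
proof -
  have "((\<lambda>t. N (p + t *\<^sub>R e) \<bullet> g (p + t *\<^sub>R e)) has_vector_derivative
      N p \<bullet> pd e g p + pd e N p \<bullet> g p) (at 0)"
    using bounded_bilinear.has_vector_derivative[OF bounded_bilinear_inner
        smooth_on2_has_vector_derivative[OF N U(2) e] smooth_on2_has_vector_derivative[OF g UNIV_I e, of p]]
    by simp
  moreover have "((\<lambda>t. N (p + t *\<^sub>R e) \<bullet> g (p + t *\<^sub>R e)) has_vector_derivative 0) (at 0)"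
  proof (rule has_vector_derivative_transform_within_open)
    show "((\<lambda>t. 0) has_vector_derivative 0) (at (0::real))" by simp
    show "open ((\<lambda>t. p + t *\<^sub>R e) -` U)"
      by (intro open_vimage U continuous_intros)
  qed (use U 0 in auto)
  ultimately show ?thesis
    using vector_derivative_unique_at by fastforce
qed

text \<open>The Ricci equation. Derivatives of the tangential coefficients of N only multiply tangent vectors,
  so they are invisible to w.\<close>
lemma R_perp_inner_normal:
  fixes f N :: "real \<times> real \<Rightarrow> real^4"
  assumes f: "smooth_on2 UNIV f" and N: "smooth_on2 U N" and U: "open U" "p \<in> U"
    and Nn: "\<And>q. q \<in> U \<Longrightarrow> N q \<bullet> pd e_u f q = 0" "\<And>q. q \<in> U \<Longrightarrow> N q \<bullet> pd e_v f q = 0"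
    and w: "pd e_u f p \<bullet> w = 0" "pd e_v f p \<bullet> w = 0"
    and D: "gD f p \<noteq> 0"
  defines "a \<equiv> pd e_u (pd e_u f) p" and "b \<equiv> pd e_u (pd e_v f) p" and "c \<equiv> pd e_v (pd e_v f) p"
  shows "R_perp f N p \<bullet> w =
    (gG f p * ((N p \<bullet> b) * (a \<bullet> w) - (N p \<bullet> a) * (b \<bullet> w))
     - gF f p * ((N p \<bullet> c) * (a \<bullet> w) - (N p \<bullet> a) * (c \<bullet> w))
     + gE f p * ((N p \<bullet> c) * (b \<bullet> w) - (N p \<bullet> b) * (c \<bullet> w))) / gD f p"
proof -
  have bb: "pd e_v (pd e_u f) p = b"
    using pd_commute[OF f open_UNIV UNIV_I] by (simp add: b_def)
  have NN: "pd e_u (pd e_v N) p = pd e_v (pd e_u N) p"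
    by (rule pd_commute[OF N U])
  note fu = smooth_on2_pd[OF f, of e_u, simplified] and fv = smooth_on2_pd[OF f, of e_v, simplified]
  \<comment> \<open>\<open>A\<close> and \<open>B\<close> are the coordinates of the tangential part
    of \<open>pd e N\<close> in the basis of coordinate fields, obtained by inverting the Gram
    matrix.\<close>
  define A where "A e q = (gG f q * (pd e N q \<bullet> pd e_u f q) - gF f q * (pd e N q \<bullet> pd e_v f q)) / gD f q" for e q
  define B where "B e q = (gE f q * (pd e N q \<bullet> pd e_v f q) - gF f q * (pd e N q \<bullet> pd e_u f q)) / gD f q" for e q
  have nab: "nabla_perp f e N = (\<lambda>q. pd e N q - A e q *\<^sub>R pd e_u f q - B e q *\<^sub>R pd e_v f q)" for e
    by (rule ext) (simp add: nabla_perp_def nproj_def A_def B_def)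
  have key: "pd e' (nabla_perp f e N) p \<bullet> w = pd e' (pd e N) p \<bullet> w
      - A e p * (pd e' (pd e_u f) p \<bullet> w) - B e p * (pd e' (pd e_v f) p \<bullet> w)"
    if e: "e \<in> {e_u, e_v}" and e': "e' \<in> {e_u, e_v}" for e e'
  proof -
    let ?l = "\<lambda>t. p + t *\<^sub>R e'"
    obtain E' F' G' where d:
      "((\<lambda>t. gE f (?l t)) has_real_derivative E') (at 0)"
      "((\<lambda>t. gF f (?l t)) has_real_derivative F') (at 0)"
      "((\<lambda>t. gG f (?l t)) has_real_derivative G') (at 0)"
      using first_fundamental_form_differentiable[OF f e', of p] by blast
    note Ne = smooth_on2_has_vector_derivative[OF smooth_on2_pd[OF N e] U(2) e']
    note fu' = smooth_on2_has_vector_derivative[OF fu UNIV_I e', of p]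
    note fv' = smooth_on2_has_vector_derivative[OF fv UNIV_I e', of p]
    have iu: "((\<lambda>t. pd e N (?l t) \<bullet> pd e_u f (?l t)) has_real_derivative
        pd e N p \<bullet> pd e' (pd e_u f) p + pd e' (pd e N) p \<bullet> pd e_u f p) (at 0)"
      using bounded_bilinear.has_vector_derivative[OF bounded_bilinear_inner Ne fu']
      by (simp add: has_real_derivative_iff_has_vector_derivative)
    have iv: "((\<lambda>t. pd e N (?l t) \<bullet> pd e_v f (?l t)) has_real_derivative
        pd e N p \<bullet> pd e' (pd e_v f) p + pd e' (pd e N) p \<bullet> pd e_v f p) (at 0)"
      using bounded_bilinear.has_vector_derivative[OF bounded_bilinear_inner Ne fv']
      by (simp add: has_real_derivative_iff_has_vector_derivative)
    have D0: "gE f (?l 0) * gG f (?l 0) - (gF f (?l 0))\<^sup>2 \<noteq> 0"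
      using D by (simp add: gD_def)
    obtain A' where A': "((\<lambda>t. A e (?l t)) has_real_derivative A') (at 0)"
      unfolding A_def gD_def
      using DERIV_divide[OF DERIV_diff[OF DERIV_mult[OF d(3) iu] DERIV_mult[OF d(2) iv]]
          DERIV_diff[OF DERIV_mult[OF d(1) d(3)] DERIV_power[OF d(2), of 2]] D0] by blast
    obtain B' where B': "((\<lambda>t. B e (?l t)) has_real_derivative B') (at 0)"
      unfolding B_def gD_def
      using DERIV_divide[OF DERIV_diff[OF DERIV_mult[OF d(1) iv] DERIV_mult[OF d(2) iu]]
          DERIV_diff[OF DERIV_mult[OF d(1) d(3)] DERIV_power[OF d(2), of 2]] D0] by blast
    have "pd e' (nabla_perp f e N) p = pd e' (pd e N) p
        - (A e p *\<^sub>R pd e' (pd e_u f) p + A' *\<^sub>R pd e_u f p)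
        - (B e p *\<^sub>R pd e' (pd e_v f) p + B' *\<^sub>R pd e_v f p)"
      unfolding pd_def[of e' "nabla_perp f e N"] unfolding nab
      by (intro vector_derivative_at)
        (use has_vector_derivative_diff[OF has_vector_derivative_diff[OF Ne
            has_vector_derivative_scaleR[OF A' fu']] has_vector_derivative_scaleR[OF B' fv']] in simp)
    then show ?thesis
      using w by (simp add: inner_diff_left inner_add_left)
  qed
  have P: "pd e N p \<bullet> pd e_u f p = - (N p \<bullet> pd e (pd e_u f) p)"
    "pd e N p \<bullet> pd e_v f p = - (N p \<bullet> pd e (pd e_v f) p)" if "e \<in> {e_u, e_v}" for e
    using that inner_pd_of_orthogonal[OF N fu U that Nn(1)] inner_pd_of_orthogonal[OF N fv U that Nn(2)] by auto
  have "R_perp f N p \<bullet> w = pd e_u (nabla_perp f e_v N) p \<bullet> w - pd e_v (nabla_perp f e_u N) p \<bullet> w"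
    unfolding R_perp_def nabla_perp_def[of f e_u "nabla_perp f e_v N"]
      nabla_perp_def[of f e_v "nabla_perp f e_u N"]
    using w by (simp add: inner_diff_left inner_nproj)
  \<comment> \<open>The second derivatives of \<open>N\<close> cancel by \<open>NN\<close>; the
    first derivatives left in \<open>A\<close> and \<open>B\<close> are removed by \<open>P\<close>
    below.\<close>
  also have "\<dots> = - A e_v p * (a \<bullet> w) - B e_v p * (b \<bullet> w) + A e_u p * (b \<bullet> w) + B e_u p * (c \<bullet> w)"
    using key[of e_v e_u] key[of e_u e_v] by (simp add: NN a_def bb c_def flip: b_def)
  also have "\<dots> = (gG f p * ((N p \<bullet> b) * (a \<bullet> w) - (N p \<bullet> a) * (b \<bullet> w))
     - gF f p * ((N p \<bullet> c) * (a \<bullet> w) - (N p \<bullet> a) * (c \<bullet> w))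
     + gE f p * ((N p \<bullet> c) * (b \<bullet> w) - (N p \<bullet> b) * (c \<bullet> w))) / gD f p"
    unfolding A_def B_def using D
    by (simp add: P bb divide_simps flip: a_def b_def c_def) (simp add: algebra_simps)
  finally show ?thesis .
qed

section \<open>Determinants and orthonormal normal frames in R^4\<close>

text \<open>The Leibniz sum, with the permutations of four indices built up by adding one index at a
  time, collected along the first row.\<close>

lemma det_4:
  fixes A :: "'a::comm_ring_1^4^4"
  shows "det A =
    A$1$1 * (A$2$2*A$3$3*A$4$4 + A$2$3*A$3$4*A$4$2 + A$2$4*A$3$2*A$4$3
           - A$2$2*A$3$4*A$4$3 - A$2$3*A$3$2*A$4$4 - A$2$4*A$3$3*A$4$2)
  - A$1$2 * (A$2$1*A$3$3*A$4$4 + A$2$3*A$3$4*A$4$1 + A$2$4*A$3$1*A$4$3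
           - A$2$1*A$3$4*A$4$3 - A$2$3*A$3$1*A$4$4 - A$2$4*A$3$3*A$4$1)
  + A$1$3 * (A$2$1*A$3$2*A$4$4 + A$2$2*A$3$4*A$4$1 + A$2$4*A$3$1*A$4$2
           - A$2$1*A$3$4*A$4$2 - A$2$2*A$3$1*A$4$4 - A$2$4*A$3$2*A$4$1)
  - A$1$4 * (A$2$1*A$3$2*A$4$3 + A$2$2*A$3$3*A$4$1 + A$2$3*A$3$1*A$4$2
           - A$2$1*A$3$3*A$4$2 - A$2$2*A$3$1*A$4$3 - A$2$3*A$3$2*A$4$1)"
proof -
  have f1: "finite {2::4, 3, 4}" "1 \<notin> {2::4, 3, 4}" by auto
  have f2: "finite {3::4, 4}" "2 \<notin> {3::4, 4}" by auto
  have f3: "finite {4::4}" "3 \<notin> {4::4}" by auto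
  show ?thesis
    unfolding det_def UNIV_4
    unfolding sum_over_permutations_insert[OF f1]
    unfolding sum_over_permutations_insert[OF f2]
    unfolding sum_over_permutations_insert[OF f3]
    unfolding permutes_sing
    by (simp add: sign_swap_id permutation_swap_id sign_compose sign_id swap_id_eq
        permutation_compose) (simp only: algebra_simps)
qed

lemma det4_eq:
  "det4 a b c d =
    a$1 * (b$2*c$3*d$4 + b$3*c$4*d$2 + b$4*c$2*d$3 - b$2*c$4*d$3 - b$3*c$2*d$4 - b$4*c$3*d$2)
  - a$2 * (b$1*c$3*d$4 + b$3*c$4*d$1 + b$4*c$1*d$3 - b$1*c$4*d$3 - b$3*c$1*d$4 - b$4*c$3*d$1)
  + a$3 * (b$1*c$2*d$4 + b$2*c$4*d$1 + b$4*c$1*d$2 - b$1*c$4*d$2 - b$2*c$1*d$4 - b$4*c$2*d$1)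
  - a$4 * (b$1*c$2*d$3 + b$2*c$3*d$1 + b$3*c$1*d$2 - b$1*c$3*d$2 - b$2*c$1*d$3 - b$3*c$2*d$1)"
  unfolding det4_def det_4 by simp

text \<open>Bilinearity and alternation in the last two arguments. The factor is the determinant of
  the change of normal basis, so its sign compares orientations.\<close>

lemma det4_linear_combination:
  "det4 a b (x *\<^sub>R c + y *\<^sub>R d) (z *\<^sub>R c + w *\<^sub>R d) = (x * w - y * z) * det4 a b c d"
proof -
  have lin3: "det4 a b (x *\<^sub>R c + y *\<^sub>R d) e = x * det4 a b c e + y * det4 a b d e" for e
    unfolding det4_eq vector_add_component vector_scaleR_component real_scaleR_def
    by (simp add: algebra_simps)
  have lin4: "det4 a b e (z *\<^sub>R c + w *\<^sub>R d) = z * det4 a b e c + w * det4 a b e d" for e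
    unfolding det4_eq vector_add_component vector_scaleR_component real_scaleR_def
    by (simp add: algebra_simps)
  have alt: "det4 a b e e = 0" "det4 a b d c = - det4 a b c d" for e
    unfolding det4_eq by algebra+
  show ?thesis
    unfolding lin3 lin4 alt by (simp add: algebra_simps)
qed

text \<open>\<open>r\<close> lies in the kernel of the invertible matrix with rows \<open>a\<close>,
  \<open>b\<close>, \<open>c\<close>, \<open>d\<close>.\<close>

lemma det4_nonzero_orthogonal_imp_0:
  assumes "det4 a b c d \<noteq> 0" "a \<bullet> r = 0" "b \<bullet> r = 0" "c \<bullet> r = 0" "d \<bullet> r = 0"
  shows "r = 0"
proof -
  let ?A = "(\<chi> i. if i = 1 then a else if i = 2 then b else if i = 3 then c else d) :: real^4^4"
  have "?A *v r = 0"
    using assms(2-) by (simp add: vec_eq_iff matrix_vector_mul_component forall_4)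
  moreover have "invertible ?A"
    using assms(1) by (simp add: invertible_det_nz det4_def)
  ultimately show ?thesis
    using matrix_left_invertible_ker[of ?A] invertible_left_inverse[of ?A] by blast
qed

text \<open>The remainder is orthogonal to \<open>a\<close> and \<open>b\<close> because all three
  terms are, and to \<open>c\<close> and \<open>d\<close> by orthonormality.\<close>

lemma orthonormal_expansion:
  assumes "det4 a b c d \<noteq> 0" "norm c = 1" "norm d = 1" "c \<bullet> d = 0"
    and "c \<bullet> a = 0" "c \<bullet> b = 0" "d \<bullet> a = 0" "d \<bullet> b = 0" "x \<bullet> a = 0" "x \<bullet> b = 0"
  shows "x = (x \<bullet> c) *\<^sub>R c + (x \<bullet> d) *\<^sub>R d"
proof -
  have *: "c \<bullet> c = 1" "d \<bullet> d = 1" "d \<bullet> c = 0"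
    "a \<bullet> c = 0" "b \<bullet> c = 0" "a \<bullet> d = 0" "b \<bullet> d = 0" "a \<bullet> x = 0" "b \<bullet> x = 0"
    using assms by (simp_all only: inner_commute dot_square_norm power_one)
  have "x - (x \<bullet> c) *\<^sub>R c - (x \<bullet> d) *\<^sub>R d = 0"
    by (rule det4_nonzero_orthogonal_imp_0[OF assms(1)])
      (simp_all add: inner_diff_right * assms(4) inner_commute[of c x] inner_commute[of d x])
  then show ?thesis by (simp add: algebra_simps)
qed

text \<open>The right side of the Ricci equation is built from 2 by 2 minors in the pair of normals.
  These scale by the determinant of the change of frame, which is 1 for two positive orthonormal
  frames.\<close>

lemma R_perp_frame_independent:
  assumes f: "smooth_on2 UNIV f" and D: "gD f p \<noteq> 0"
    and N: "normal_frame f U N1 N2" "p \<in> U" and M: "normal_frame f V M1 M2" "p \<in> V"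
  shows "R_perp f N2 p \<bullet> N1 p = R_perp f M2 p \<bullet> M1 p"
proof -
  let ?a = "pd e_u f p" and ?b = "pd e_v f p"
  have N': "open U" "smooth_on2 U N2" "\<And>q. q \<in> U \<Longrightarrow> N2 q \<bullet> pd e_u f q = 0"
    "\<And>q. q \<in> U \<Longrightarrow> N2 q \<bullet> pd e_v f q = 0"
    "norm (N1 p) = 1" "norm (N2 p) = 1" "N1 p \<bullet> N2 p = 0" "N1 p \<bullet> ?a = 0" "N1 p \<bullet> ?b = 0"
    "det4 ?a ?b (N1 p) (N2 p) > 0"
    using N by (auto simp: normal_frame_def)
  have M': "open V" "smooth_on2 V M2" "\<And>q. q \<in> V \<Longrightarrow> M2 q \<bullet> pd e_u f q = 0"
    "\<And>q. q \<in> V \<Longrightarrow> M2 q \<bullet> pd e_v f q = 0"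
    "norm (M1 p) = 1" "norm (M2 p) = 1" "M1 p \<bullet> M2 p = 0" "M1 p \<bullet> ?a = 0" "M1 p \<bullet> ?b = 0"
    "det4 ?a ?b (M1 p) (M2 p) > 0"
    using M by (auto simp: normal_frame_def)
  define x y z w where "x = N1 p \<bullet> M1 p" and "y = N1 p \<bullet> M2 p"
    and "z = N2 p \<bullet> M1 p" and "w = N2 p \<bullet> M2 p"
  have N1: "N1 p = x *\<^sub>R M1 p + y *\<^sub>R M2 p"
    unfolding x_def y_def
    by (rule orthonormal_expansion[of ?a ?b]) (use M' M(2) N' in auto)
  have N2: "N2 p = z *\<^sub>R M1 p + w *\<^sub>R M2 p"
    unfolding z_def w_def
    by (rule orthonormal_expansion[of ?a ?b]) (use M' M(2) N' N(2) in auto)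
  have MM: "M1 p \<bullet> M1 p = 1" "M2 p \<bullet> M2 p = 1" "M2 p \<bullet> M1 p = 0"
    using M' by (auto simp: inner_commute simp flip: power2_norm_eq_inner)
  have NN: "N1 p \<bullet> N1 p = 1" "N2 p \<bullet> N2 p = 1" "N1 p \<bullet> N2 p = 0"
    using N' by (auto simp flip: power2_norm_eq_inner)
  have "x * x + y * y = 1" "z * z + w * w = 1" "x * z + y * w = 0"
    using NN unfolding N1 N2
    by (simp_all add: inner_add_left inner_add_right MM M'(7) mult.commute)
  \<comment> \<open>Lagrange's identity: (x^2 + y^2)(z^2 + w^2) = (xz + yw)^2 + (xw - yz)^2. The
    sign is settled next by the orientation.\<close>
  then have "(x * w - y * z)\<^sup>2 = 1" by algebra
  moreover have "(x * w - y * z) * det4 ?a ?b (M1 p) (M2 p) > 0"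
    using N'(10) unfolding N1 N2 det4_linear_combination .
  then have "x * w - y * z > 0" using M'(10) by (simp add: zero_less_mult_iff)
  ultimately have 1: "x * w - y * z = 1" by (simp add: power2_eq_1_iff)
  have swap: "(N2 p \<bullet> t) * (s \<bullet> N1 p) - (N2 p \<bullet> s) * (t \<bullet> N1 p) =
     (M2 p \<bullet> t) * (s \<bullet> M1 p) - (M2 p \<bullet> s) * (t \<bullet> M1 p)" for s t
  proof -
    have "(N2 p \<bullet> t) * (s \<bullet> N1 p) - (N2 p \<bullet> s) * (t \<bullet> N1 p) =
      (x * w - y * z) * ((M2 p \<bullet> t) * (s \<bullet> M1 p) - (M2 p \<bullet> s) * (t \<bullet> M1 p))"
      unfolding N1 N2 inner_add_left inner_add_right inner_scaleR_left inner_scaleR_right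
        inner_commute[of s] inner_commute[of t] by algebra
    then show ?thesis using 1 by simp
  qed
  have "?a \<bullet> N1 p = 0" "?b \<bullet> N1 p = 0" "?a \<bullet> M1 p = 0" "?b \<bullet> M1 p = 0"
    using N' M' by (auto simp: inner_commute)
  note RN = R_perp_inner_normal[OF f N'(2,1) N(2) N'(3,4) this(1,2) D]
    and RM = R_perp_inner_normal[OF f M'(2,1) M(2) M'(3,4) this(3,4) D]
  show ?thesis by (simp only: RN RM swap)
qed

text \<open>Resolves the \<open>SOME\<close>: frame independence leaves one candidate, so any
  convenient frame computes it.\<close>

lemma K_perp_eq:
  assumes f: "smooth_on2 UNIV f" and D: "gD f p \<noteq> 0" and M: "normal_frame f V M1 M2" "p \<in> V"
  shows "K_perp f p = (R_perp f M2 p \<bullet> M1 p) / sqrt (gD f p)"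
  unfolding K_perp_def
proof (rule some_equality)
  show "\<exists>U N1 N2. normal_frame f U N1 N2 \<and> p \<in> U \<and>
      R_perp f M2 p \<bullet> M1 p / sqrt (gD f p) = R_perp f N2 p \<bullet> N1 p / sqrt (gD f p)"
    using M by blast
qed (use R_perp_frame_independent[OF f D _ _ M] in auto)

section \<open>Rotationally symmetric maps\<close>

definition vec4 :: "real \<Rightarrow> real \<Rightarrow> real \<Rightarrow> real \<Rightarrow> real^4" where
  "vec4 a b c d = (\<chi> i. if i = 1 then a else if i = 2 then b else if i = 3 then c else d)"

lemma vec4_nth [simp]: "vec4 a b c d $ 1 = a" "vec4 a b c d $ 2 = b" "vec4 a b c d $ 3 = c" "vec4 a b c d $ 4 = d"
  by (simp_all add: vec4_def)

lemma vec4_axis: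
  "vec4 a b c d = a *\<^sub>R axis 1 1 + b *\<^sub>R axis 2 1 + c *\<^sub>R axis 3 1 + d *\<^sub>R axis 4 1"
  by (simp add: vec_eq_iff forall_4 axis_def)

lemma has_vector_derivative_vec4:
  assumes "(a has_real_derivative a') (at t)" "(b has_real_derivative b') (at t)"
    "(c has_real_derivative c') (at t)" "(d has_real_derivative d') (at t)"
  shows "((\<lambda>t. vec4 (a t) (b t) (c t) (d t)) has_vector_derivative vec4 a' b' c' d') (at t)"
  unfolding vec4_axis
  by (intro has_vector_derivative_add) (use assms has_vector_derivative_scaleR[OF _ has_vector_derivative_const] in force)+

text \<open>The vector (a + ib, c + id) of C^2 = R^4 moved by the rotation (e^{i pi u}, e^{2 i pi u}).\<close>
definition rot :: "real \<Rightarrow> real \<Rightarrow> real \<Rightarrow> real \<Rightarrow> real \<Rightarrow> real^4" where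
  "rot u a b c d = vec4 (a * cos (pi * u) - b * sin (pi * u)) (a * sin (pi * u) + b * cos (pi * u))
     (c * cos (2 * pi * u) - d * sin (2 * pi * u)) (c * sin (2 * pi * u) + d * cos (2 * pi * u))"

text \<open>The rotation is orthogonal, so \<open>u\<close> drops out. This is how the symmetry
  makes all metric quantities depend on \<open>v\<close> alone.\<close>

lemma inner_rot: "rot u a b c d \<bullet> rot u a' b' c' d' = a * a' + b * b' + c * c' + d * d'"
proof -
  have 1: "(cos (pi * u))\<^sup>2 + (sin (pi * u))\<^sup>2 = 1" "(cos (2 * pi * u))\<^sup>2 + (sin (2 * pi * u))\<^sup>2 = 1"
    by simp_all
  show ?thesis
    unfolding rot_def inner_vec_def sum_4 vec4_nth inner_real_def using 1 by algebra
qed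

lemma rot_cong:
  "a = a' \<Longrightarrow> b = b' \<Longrightarrow> c = c' \<Longrightarrow> d = d' \<Longrightarrow> rot u a b c d = rot u a' b' c' d'"
  by simp

lemma rot_scaleR: "x *\<^sub>R rot u a b c d = rot u (x * a) (x * b) (x * c) (x * d)"
  by (simp add: rot_def vec_eq_iff forall_4 algebra_simps)

lemma rot_add: "rot u a b c d + rot u a' b' c' d' = rot u (a + a') (b + b') (c + c') (d + d')"
  by (simp add: rot_def vec_eq_iff forall_4 algebra_simps)

lemma rot_diff: "rot u a b c d - rot u a' b' c' d' = rot u (a - a') (b - b') (c - c') (d - d')"
  by (simp add: rot_def vec_eq_iff forall_4 algebra_simps)

lemma rot_eq_0_iff: "rot u a b c d = 0 \<longleftrightarrow> a = 0 \<and> b = 0 \<and> c = 0 \<and> d = 0"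
proof
  assume "rot u a b c d = 0"
  then have "a * a + b * b + c * c + d * d = 0"
    using inner_rot[of u a b c d a b c d] by simp
  then show "a = 0 \<and> b = 0 \<and> c = 0 \<and> d = 0"
    by (smt (verit) zero_le_square mult_eq_0_iff)
qed (simp add: rot_def vec_eq_iff forall_4)

text \<open>The rotation has determinant 1. The zeros match the later frame: the u-derivative and
  second normal have only imaginary coordinates, the v-derivative and first normal only real ones,
  so the determinant splits into two 2 by 2 factors.\<close>

lemma det4_rot:
  "det4 (rot u 0 a 0 b) (rot u c 0 d 0) (rot u e 0 f 0) (rot u 0 g 0 h) = (c * f - d * e) * (b * g - a * h)"
proof -
  have 1: "(cos (pi * u))\<^sup>2 + (sin (pi * u))\<^sup>2 = 1" "(cos (2 * pi * u))\<^sup>2 + (sin (2 * pi * u))\<^sup>2 = 1"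
    by simp_all
  show ?thesis
    unfolding rot_def det4_eq vec4_nth using 1 by algebra
qed

text \<open>The generator of the action multiplies z by i pi and w by 2 i pi, so the derivative is
  again of the form \<open>rot\<close>.\<close>

lemma has_vector_derivative_rot_u:
  "((\<lambda>t. rot (fst (p + t *\<^sub>R e_u)) (a (snd (p + t *\<^sub>R e_u))) (b (snd (p + t *\<^sub>R e_u)))
      (c (snd (p + t *\<^sub>R e_u))) (d (snd (p + t *\<^sub>R e_u)))) has_vector_derivative
    rot (fst p) (- pi * b (snd p)) (pi * a (snd p)) (- 2 * pi * d (snd p)) (2 * pi * c (snd p))) (at 0)"
  unfolding rot_def e_u_def
  by (rule has_vector_derivative_vec4) (auto intro!: derivative_eq_intros simp: algebra_simps)

lemma has_vector_derivative_rot_v: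
  assumes "\<And>v. (a has_real_derivative a' v) (at v)" "\<And>v. (b has_real_derivative b' v) (at v)"
    "\<And>v. (c has_real_derivative c' v) (at v)" "\<And>v. (d has_real_derivative d' v) (at v)"
  shows "((\<lambda>t. rot (fst (p + t *\<^sub>R e_v)) (a (snd (p + t *\<^sub>R e_v))) (b (snd (p + t *\<^sub>R e_v)))
      (c (snd (p + t *\<^sub>R e_v))) (d (snd (p + t *\<^sub>R e_v)))) has_vector_derivative
    rot (fst p) (a' (snd p)) (b' (snd p)) (c' (snd p)) (d' (snd p))) (at 0)"
proof -
  have sh: "((\<lambda>t. g (snd p + t)) has_real_derivative g' (snd p)) (at 0)"
    if "\<And>v. (g has_real_derivative g' v) (at v)" for g g' :: "real \<Rightarrow> real"
    using that[of "snd p"] DERIV_shift[of g "g' (snd p)" 0 "snd p"] by (simp add: add.commute)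
  show ?thesis
    unfolding rot_def e_v_def
    by (rule has_vector_derivative_vec4)
      (auto intro!: derivative_eq_intros sh[OF assms(1)] sh[OF assms(2)] sh[OF assms(3)] sh[OF assms(4)])
qed

lemma pd_rot_u:
  "pd e_u (\<lambda>p. rot (fst p) (a (snd p)) (b (snd p)) (c (snd p)) (d (snd p))) =
    (\<lambda>p. rot (fst p) (- pi * b (snd p)) (pi * a (snd p)) (- 2 * pi * d (snd p)) (2 * pi * c (snd p)))"
  unfolding pd_def by (intro ext vector_derivative_at has_vector_derivative_rot_u)

lemma pd_rot_v:
  assumes "\<And>v. (a has_real_derivative a' v) (at v)" "\<And>v. (b has_real_derivative b' v) (at v)"
    "\<And>v. (c has_real_derivative c' v) (at v)" "\<And>v. (d has_real_derivative d' v) (at v)"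
  shows "pd e_v (\<lambda>p. rot (fst p) (a (snd p)) (b (snd p)) (c (snd p)) (d (snd p))) =
    (\<lambda>p. rot (fst p) (a' (snd p)) (b' (snd p)) (c' (snd p)) (d' (snd p)))"
  unfolding pd_def by (intro ext vector_derivative_at has_vector_derivative_rot_v assms)

section \<open>Smoothness of rotated profiles\<close>

text \<open>A class closed under differentiation that contains all coefficients needed. The phase in
  \<open>cos\<close> covers sines; \<open>inverse_sqrt\<close> serves the normalised normal, and its
  derivative -1/2 g' (g^(-1/2))^3 stays in the class.\<close>

inductive elementary :: "(real \<Rightarrow> real) \<Rightarrow> bool" where
  const: "elementary (\<lambda>v. c)"
| cos: "elementary (\<lambda>v. cos (k * v + c))"
| add: "elementary g \<Longrightarrow> elementary h \<Longrightarrow> elementary (\<lambda>v. g v + h v)"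
| mult: "elementary g \<Longrightarrow> elementary h \<Longrightarrow> elementary (\<lambda>v. g v * h v)"
| inverse_sqrt: "elementary g \<Longrightarrow> (\<And>v. g v > 0) \<Longrightarrow> elementary (\<lambda>v. inverse (sqrt (g v)))"

lemma elementary_deriv:
  "elementary g \<Longrightarrow> \<exists>g'. elementary g' \<and> (\<forall>v. (g has_real_derivative g' v) (at v))"
proof (induction rule: elementary.induct)
  case (const c)
  show ?case by (intro exI[of _ "\<lambda>v. 0"]) (simp add: elementary.const)
next
  case (cos k c)
  have "((\<lambda>v. cos (k * v + c)) has_real_derivative k * cos (k * v + (c + pi / 2))) (at v)" for v
    using cos_add[of "k * v + c" "pi / 2"] by (auto intro!: derivative_eq_intros simp: add.assoc)
  then show ?case
    by (intro exI[of _ "\<lambda>v. k * cos (k * v + (c + pi / 2))"]) (auto intro: elementary.intros)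
next
  case (add g h)
  then obtain g' h' where "elementary g'" "elementary h'"
    "\<And>v. (g has_real_derivative g' v) (at v)" "\<And>v. (h has_real_derivative h' v) (at v)" by blast
  then show ?case
    by (intro exI[of _ "\<lambda>v. g' v + h' v"]) (auto intro!: elementary.intros DERIV_add)
next
  case (mult g h)
  then obtain g' h' where *: "elementary g'" "elementary h'"
    "\<And>v. (g has_real_derivative g' v) (at v)" "\<And>v. (h has_real_derivative h' v) (at v)" by blast
  have "elementary (\<lambda>v. g' v * h v + h' v * g v)"
    using * mult by (intro elementary.intros)
  then show ?case using DERIV_mult[OF *(3) *(4)] by blast
next
  case (inverse_sqrt g)
  then obtain g' where *: "elementary g'" "\<And>v. (g has_real_derivative g' v) (at v)" by blast
  let ?i = "\<lambda>v. inverse (sqrt (g v))"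
  let ?d = "\<lambda>v. (- 1 / 2) * g' v * (?i v * ?i v * ?i v)"
  have "((\<lambda>v. ?i v) has_real_derivative ?d v) (at v)" for v
    using inverse_sqrt(2)[of v]
    by (auto intro!: derivative_eq_intros *(2) simp: field_simps)
  moreover have "elementary ?d"
    using * inverse_sqrt by (intro elementary.intros)
  ultimately show ?case by blast
qed

lemma elementary_uminus: "elementary g \<Longrightarrow> elementary (\<lambda>v. - g v)"
  using elementary.mult[OF elementary.const[of "-1"]] by simp

lemma elementary_continuous: "elementary g \<Longrightarrow> continuous_on UNIV g"
  using elementary_deriv DERIV_continuous_on has_field_derivative_at_within by metis

lemma elementary_cos_2pi: "elementary (\<lambda>v. cos (2 * pi * v))"
  using elementary.cos[of "2 * pi" 0] by simp

lemma elementary_sin_2pi: "elementary (\<lambda>v. sin (2 * pi * v))"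
  using elementary.cos[of "2 * pi" "- (pi / 2)"] by (simp add: cos_diff)

text \<open>Coinduction on all \<open>rot\<close> maps with elementary coefficients: a u-derivative
  permutes and scales the coefficients, a v-derivative differentiates them.\<close>

lemma smooth_rot:
  assumes "elementary a" "elementary b" "elementary c" "elementary d"
  shows "smooth_on2 UNIV (\<lambda>p. rot (fst p) (a (snd p)) (b (snd p)) (c (snd p)) (d (snd p)))"
proof (rule smooth_on2_coinduct)
  let ?S = "{\<lambda>p. rot (fst p) (a (snd p)) (b (snd p)) (c (snd p)) (d (snd p)) | a b c d.
    elementary a \<and> elementary b \<and> elementary c \<and> elementary d}"
  have mem: "(\<lambda>p. rot (fst p) (a (snd p)) (b (snd p)) (c (snd p)) (d (snd p))) \<in> ?S"
    if "elementary a" "elementary b" "elementary c" "elementary d" for a b c d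
    using that by blast
  show "(\<lambda>p. rot (fst p) (a (snd p)) (b (snd p)) (c (snd p)) (d (snd p))) \<in> ?S"
    by (rule mem[OF assms])
  fix g assume "g \<in> ?S"
  then obtain a b c d where g: "g = (\<lambda>p. rot (fst p) (a (snd p)) (b (snd p)) (c (snd p)) (d (snd p)))"
    and el: "elementary a" "elementary b" "elementary c" "elementary d" by blast
  have "continuous_on UNIV (\<lambda>p::real \<times> real. h (snd p))" if "elementary h" for h
    by (rule continuous_on_compose2[OF elementary_continuous[OF that]]) (auto intro: continuous_intros)
  then show "continuous_on UNIV g"
    unfolding g rot_def vec4_axis using el by (intro continuous_intros) auto
  fix e assume "e \<in> {e_u, e_v}"
  then consider "e = e_u" | "e = e_v" by blast
  then show "\<exists>g'\<in>?S. \<forall>q. ((\<lambda>t. g (q + t *\<^sub>R e)) has_vector_derivative g' q) (at 0)"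
  proof cases
    case 1
    have "elementary (\<lambda>v. - pi * b v)" "elementary (\<lambda>v. pi * a v)"
      "elementary (\<lambda>v. - 2 * pi * d v)" "elementary (\<lambda>v. 2 * pi * c v)"
      by (insert el) ((rule elementary.mult[OF elementary.const], assumption)+)
    from mem[OF this] show ?thesis
      unfolding 1 g by (rule bexI[rotated]) (intro allI has_vector_derivative_rot_u)
  next
    case 2
    obtain a' b' c' d' where "elementary a'" "elementary b'" "elementary c'" "elementary d'"
      "\<And>v. (a has_real_derivative a' v) (at v)" "\<And>v. (b has_real_derivative b' v) (at v)"
      "\<And>v. (c has_real_derivative c' v) (at v)" "\<And>v. (d has_real_derivative d' v) (at v)"
      using el elementary_deriv by metis
    with mem[of a' b' c' d'] has_vector_derivative_rot_v[of a a' b b' c c' d d'] show ?thesis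
      unfolding 2 g by (intro bexI[of _ "\<lambda>p. rot (fst p) (a' (snd p)) (b' (snd p)) (c' (snd p)) (d' (snd p))"]) auto
  qed
qed

section \<open>The Klein bottle\<close>

abbreviation sin_turn where "sin_turn v \<equiv> sin (2 * pi * v)"
abbreviation cos_turn where "cos_turn v \<equiv> cos (2 * pi * v)"

text \<open>The centre 3/2 is a convenient choice: numerically, unit profile circles centred at height b
  give energy below 8 pi for b between 1.01 and 2, with the minimum near b = 1.35.\<close>
definition klein :: "real \<times> real \<Rightarrow> real^4" where
  "klein p = rot (fst p) (sin_turn (snd p)) 0 (3/2 + cos_turn (snd p)) 0"

text \<open>The X of the integrand: |z|^2 + 4 |w|^2, the squared orbit speed at the profile point,
  as a polynomial in the cosine.\<close>

definition radius_sq :: "real \<Rightarrow> real" where "radius_sq v = 10 + 12 * cos_turn v + 3 * (cos_turn v)\<^sup>2"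

text \<open>Completing the square gives 3 (c + 2)^2 - 2, and c + 2 is at least 1.\<close>

lemma radius_sq_pos: "radius_sq v > 0"
proof -
  have "cos_turn v + 2 \<ge> 1" by (smt (verit) cos_ge_minus_one)
  then have "1 * 1 \<le> (cos_turn v + 2) * (cos_turn v + 2)" by (intro mult_mono) auto
  then show ?thesis by (simp add: radius_sq_def power2_eq_square algebra_simps)
qed

lemma radius_sq_eq: "radius_sq v = (sin_turn v)\<^sup>2 + 4 * (3/2 + cos_turn v)\<^sup>2"
  by (simp add: radius_sq_def sin_squared_eq power2_eq_square algebra_simps)

lemma deriv_sin_turn: "(sin_turn has_real_derivative 2 * pi * cos_turn v) (at v)"
  by (auto intro!: derivative_eq_intros)

lemma deriv_cos_turn: "(cos_turn has_real_derivative - 2 * pi * sin_turn v) (at v)"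
  by (auto intro!: derivative_eq_intros)

lemma deriv_profile: "((\<lambda>v. 3/2 + cos_turn v) has_real_derivative - 2 * pi * sin_turn v) (at v)"
  by (auto intro!: derivative_eq_intros)

lemma klein_u: "pd e_u klein = (\<lambda>p. rot (fst p) 0 (pi * sin_turn (snd p)) 0 (2 * pi * (3/2 + cos_turn (snd p))))"
  unfolding klein_def using pd_rot_u[of sin_turn "\<lambda>_. 0" "\<lambda>v. 3/2 + cos_turn v" "\<lambda>_. 0"] by simp

lemma klein_v: "pd e_v klein = (\<lambda>p. rot (fst p) (2 * pi * cos_turn (snd p)) 0 (- 2 * pi * sin_turn (snd p)) 0)"
  unfolding klein_def
  using pd_rot_v[OF deriv_sin_turn DERIV_const deriv_profile DERIV_const] by simp

lemma klein_uu: "pd e_u (pd e_u klein) =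
    (\<lambda>p. rot (fst p) (- pi\<^sup>2 * sin_turn (snd p)) 0 (- 4 * pi\<^sup>2 * (3/2 + cos_turn (snd p))) 0)"
  unfolding klein_u
  using pd_rot_u[of "\<lambda>_. 0" "\<lambda>v. pi * sin_turn v" "\<lambda>_. 0" "\<lambda>v. 2 * pi * (3/2 + cos_turn v)"]
  by (simp add: power2_eq_square mult.assoc)

lemma klein_uv: "pd e_u (pd e_v klein) =
    (\<lambda>p. rot (fst p) 0 (2 * pi\<^sup>2 * cos_turn (snd p)) 0 (- 4 * pi\<^sup>2 * sin_turn (snd p)))"
  unfolding klein_v
  using pd_rot_u[of "\<lambda>v. 2 * pi * cos_turn v" "\<lambda>_. 0" "\<lambda>v. - 2 * pi * sin_turn v" "\<lambda>_. 0"]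
  by (simp add: power2_eq_square algebra_simps)

lemma klein_vv: "pd e_v (pd e_v klein) =
    (\<lambda>p. rot (fst p) (- 4 * pi\<^sup>2 * sin_turn (snd p)) 0 (- 4 * pi\<^sup>2 * cos_turn (snd p)) 0)"
  unfolding klein_v
  using pd_rot_v[OF DERIV_cmult[OF deriv_cos_turn, of "2 * pi"] DERIV_const DERIV_cmult[OF deriv_sin_turn, of "- 2 * pi"] DERIV_const]
  by (simp add: power2_eq_square algebra_simps)

lemma gE_klein: "gE klein p = pi\<^sup>2 * radius_sq (snd p)"
  unfolding gE_def klein_u inner_rot radius_sq_eq by (simp add: power2_eq_square algebra_simps)

lemma gF_klein: "gF klein p = 0"
  unfolding gF_def klein_u klein_v inner_rot by simp

lemma gG_klein: "gG klein p = 4 * pi\<^sup>2"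
proof -
  have "gG klein p = 4 * pi\<^sup>2 * ((sin_turn (snd p))\<^sup>2 + (cos_turn (snd p))\<^sup>2)"
    unfolding gG_def klein_v inner_rot by algebra
  then show ?thesis by simp
qed

lemma gD_klein: "gD klein p = (2 * pi\<^sup>2)\<^sup>2 * radius_sq (snd p)"
  unfolding gD_def gE_klein gF_klein gG_klein by (simp add: power2_eq_square)

lemma gD_klein_pos: "gD klein p > 0"
  by (simp add: gD_klein radius_sq_pos)

lemma sqrt_gD_klein: "sqrt (gD klein p) = 2 * pi\<^sup>2 * sqrt (radius_sq (snd p))"
  unfolding gD_klein real_sqrt_mult real_sqrt_abs by simp

lemma elementary_radius_sq: "elementary radius_sq"
proof -
  have "elementary (\<lambda>v. 10 + (12 * cos_turn v + 3 * (cos_turn v * cos_turn v)))"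
    by (intro elementary.add elementary.mult elementary.const elementary_cos_2pi)
  then show ?thesis by (simp add: radius_sq_def[abs_def] power2_eq_square add.assoc)
qed

lemma elementary_inverse_radius: "elementary (\<lambda>v. inverse (sqrt (radius_sq v)))"
  by (intro elementary.inverse_sqrt elementary_radius_sq radius_sq_pos)

lemma smooth_klein: "smooth_on2 UNIV klein"
  unfolding klein_def
  by (intro smooth_rot elementary_sin_2pi elementary.const elementary.add elementary_cos_2pi)

section \<open>Mean curvature of the Klein bottle\<close>

text \<open>The Q of the integrand. Q/X is the sum of the curvature of the orbit direction along the
  profile normal and the curvature 1 of the profile circle, up to sign.\<close>

definition curv_num :: "real \<Rightarrow> real" where "curv_num v = 11 + 18 * cos_turn v + 6 * (cos_turn v)\<^sup>2"

lemma norm_mean_curv_klein: "(norm (mean_curv klein p))\<^sup>2 = (curv_num (snd p))\<^sup>2 / (radius_sq (snd p))\<^sup>2"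
proof -
  let ?u = "fst p" and ?v = "snd p"
  define s c x where "s = sin_turn ?v" and "c = cos_turn ?v" and "x = radius_sq ?v"
  have sc: "s * s + c * c = 1" by (simp add: s_def c_def flip: power2_eq_square)
  have x: "x > 0" using radius_sq_pos by (simp add: x_def)
  have xq: "s * s + 4 * (3/2 + c) * c + x = curv_num ?v"
  proof -
    have "x = 10 + 12 * c + 3 * (c * c)" "curv_num ?v = 11 + 18 * c + 6 * (c * c)"
      by (simp_all add: x_def radius_sq_def curv_num_def c_def power2_eq_square)
    then show ?thesis using sc by (simp add: algebra_simps)
  qed
  \<comment> \<open>The real coordinates of f_uu/E + f_vv/G; the metric is diagonal, so this is the
    trace before projection.\<close>
  define a d where "a = - s / x - s" and "d = - 4 * (3/2 + c) / x - c"
  have w: "(1 / gD klein p) *\<^sub>R (gG klein p *\<^sub>R pd e_u (pd e_u klein) p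
       - (2 * gF klein p) *\<^sub>R pd e_u (pd e_v klein) p + gE klein p *\<^sub>R pd e_v (pd e_v klein) p)
     = rot ?u a 0 d 0"
    unfolding gD_klein gE_klein gF_klein gG_klein klein_uu klein_vv klein_uv
      rot_scaleR rot_add rot_diff a_def d_def s_def[symmetric] c_def[symmetric] x_def[symmetric]
    using x by (intro rot_cong) (simp_all add: power2_eq_square field_simps)
  have "mean_curv klein p = nproj klein p (rot ?u a 0 d 0)"
    unfolding mean_curv_def w ..
  also have "\<dots> = rot ?u a 0 d 0 - (a * c - d * s) *\<^sub>R rot ?u c 0 (- s) 0"
    unfolding nproj_def gD_klein gE_klein gF_klein gG_klein klein_u klein_v inner_rot
      rot_scaleR rot_diff s_def[symmetric] c_def[symmetric] x_def[symmetric]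
    using x by (intro rot_cong) (simp_all add: power2_eq_square field_simps)
  also have "\<dots> = rot ?u (a - (a * c - d * s) * c) 0 (d + (a * c - d * s) * s) 0"
    by (simp add: rot_scaleR rot_diff)
  finally have mc: "mean_curv klein p = rot ?u (a - (a * c - d * s) * c) 0 (d + (a * c - d * s) * s) 0" .
  have "(norm (mean_curv klein p))\<^sup>2 = (a - (a * c - d * s) * c)\<^sup>2 + (d + (a * c - d * s) * s)\<^sup>2"
    unfolding mc power2_norm_eq_inner inner_rot by (simp add: power2_eq_square)
  \<comment> \<open>Removing the component along the unit tangent (c, -s) leaves the one along the
    unit normal (s, c).\<close>
  also have "\<dots> = (a * s + d * c)\<^sup>2"
    using sc by algebra
  also have "a * s + d * c = - ((s * s + 4 * (3/2 + c) * c + x * (s * s + c * c)) / x)"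
    using x by (simp add: a_def d_def field_simps)
  also have "\<dots> = - (curv_num ?v / x)"
    unfolding sc using xq by simp
  finally show ?thesis
    by (simp add: power_divide x_def)
qed

section \<open>Normal frame and Euler normal number\<close>

definition normal1 :: "real \<times> real \<Rightarrow> real^4" where
  "normal1 p = rot (fst p) (sin_turn (snd p)) 0 (cos_turn (snd p)) 0"

text \<open>The u-derivative turned by a quarter turn within the two imaginary coordinates and
  normalised; the direction of the turn makes the frame positive.\<close>

definition normal2 :: "real \<times> real \<Rightarrow> real^4" where
  "normal2 p = rot (fst p) 0 (2 * (3/2 + cos_turn (snd p)) * inverse (sqrt (radius_sq (snd p)))) 0
     (- sin_turn (snd p) * inverse (sqrt (radius_sq (snd p))))"

text \<open>The frame is global on the plane but does not descend to the quotient: under (u,v) to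
  (u+1,-v), \<open>normal1\<close> is preserved and \<open>normal2\<close> changes sign.\<close>

lemma normal_frame_klein: "normal_frame klein UNIV normal1 normal2"
proof -
  have s1: "smooth_on2 UNIV normal1"
    unfolding normal1_def by (intro smooth_rot elementary_sin_2pi elementary_cos_2pi elementary.const)
  have s2: "smooth_on2 UNIV normal2"
    unfolding normal2_def
    by (intro smooth_rot elementary.mult elementary.add elementary_uminus elementary_sin_2pi elementary_cos_2pi
        elementary.const elementary_inverse_radius)
  have "norm (normal1 q) = 1 \<and> norm (normal2 q) = 1 \<and> normal1 q \<bullet> normal2 q = 0 \<and>
        normal1 q \<bullet> pd e_u klein q = 0 \<and> normal1 q \<bullet> pd e_v klein q = 0 \<and>
        normal2 q \<bullet> pd e_u klein q = 0 \<and> normal2 q \<bullet> pd e_v klein q = 0 \<and>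
        det4 (pd e_u klein q) (pd e_v klein q) (normal1 q) (normal2 q) > 0" for q
  proof -
    define s c x where "s = sin_turn (snd q)" and "c = cos_turn (snd q)" and "x = radius_sq (snd q)"
    define r where "r = inverse (sqrt x)"
    have sc: "s * s + c * c = 1" by (simp add: s_def c_def flip: power2_eq_square)
    have x: "x > 0" "x = s * s + 4 * (3/2 + c) * (3/2 + c)"
      using radius_sq_pos radius_sq_eq by (simp_all add: x_def s_def c_def power2_eq_square)
    have r: "r > 0" "r * r * x = 1"
      using x(1) by (simp_all add: r_def field_simps)
    have u: "pd e_u klein q = rot (fst q) 0 (pi * s) 0 (2 * pi * (3/2 + c))"
      and v: "pd e_v klein q = rot (fst q) (2 * pi * c) 0 (- 2 * pi * s) 0"
      and m1: "normal1 q = rot (fst q) s 0 c 0"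
      and m2: "normal2 q = rot (fst q) 0 (2 * (3/2 + c) * r) 0 (- s * r)"
      by (simp_all add: klein_u klein_v normal1_def normal2_def s_def c_def r_def x_def)
    have "det4 (pd e_u klein q) (pd e_v klein q) (normal1 q) (normal2 q) =
        2 * pi * pi * r * (s * s + c * c) * (s * s + 4 * (3/2 + c) * (3/2 + c))"
      unfolding u v m1 m2 det4_rot by (simp add: algebra_simps)
    then have "det4 (pd e_u klein q) (pd e_v klein q) (normal1 q) (normal2 q) > 0"
      using r x sc by simp
    moreover have "normal1 q \<bullet> normal1 q = 1"
      unfolding m1 inner_rot using sc by simp
    moreover have "normal2 q \<bullet> normal2 q = r * r * x"
      unfolding m2 inner_rot x(2) by (simp add: algebra_simps)
    then have "normal2 q \<bullet> normal2 q = 1" using r by simp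
    moreover have "normal1 q \<bullet> normal2 q = 0" "normal1 q \<bullet> pd e_u klein q = 0" "normal1 q \<bullet> pd e_v klein q = 0"
        "normal2 q \<bullet> pd e_u klein q = 0" "normal2 q \<bullet> pd e_v klein q = 0"
      unfolding u v m1 m2 inner_rot by (simp_all add: algebra_simps)
    ultimately show ?thesis by (simp add: norm_eq_1)
  qed
  then show ?thesis
    using s1 s2 by (simp add: normal_frame_def)
qed

text \<open>The density of K^perp with respect to du dv, area factor included.\<close>

definition normal_curv :: "real \<Rightarrow> real" where
  "normal_curv v = 12 * pi\<^sup>2 * ((3/2 + cos_turn v) * (2 + 3 * cos_turn v)) * (inverse (sqrt (radius_sq v)))^3"

text \<open>In the Ricci equation F = 0, f_uu and f_vv are orthogonal to \<open>normal2\<close>, and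
  f_uv is orthogonal to \<open>normal1\<close>, so only products of a mixed and a pure second
  derivative survive.\<close>

lemma R_perp_klein: "R_perp klein normal2 p \<bullet> normal1 p = normal_curv (snd p)"
proof -
  define s c x where "s = sin_turn (snd p)" and "c = cos_turn (snd p)" and "x = radius_sq (snd p)"
  define r where "r = inverse (sqrt x)"
  have sc: "s * s + c * c = 1" by (simp add: s_def c_def flip: power2_eq_square)
  have x: "x > 0" "x = s * s + 4 * (3/2 + c) * (3/2 + c)"
    using radius_sq_pos radius_sq_eq by (simp_all add: x_def s_def c_def power2_eq_square)
  have r: "r > 0" "r * r = 1 / x"
    using x(1) by (simp_all add: r_def field_simps)
  have m1: "normal1 p = rot (fst p) s 0 c 0"
    and m2: "normal2 p = rot (fst p) 0 (2 * (3/2 + c) * r) 0 (- s * r)"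
    by (simp_all add: normal1_def normal2_def s_def c_def r_def x_def)
  have uu: "pd e_u (pd e_u klein) p = rot (fst p) (- pi\<^sup>2 * s) 0 (- 4 * pi\<^sup>2 * (3/2 + c)) 0"
    and uv: "pd e_u (pd e_v klein) p = rot (fst p) 0 (2 * pi\<^sup>2 * c) 0 (- 4 * pi\<^sup>2 * s)"
    and vv: "pd e_v (pd e_v klein) p = rot (fst p) (- 4 * pi\<^sup>2 * s) 0 (- 4 * pi\<^sup>2 * c) 0"
    unfolding klein_uu klein_uv klein_vv s_def c_def by (rule refl)+
  have i: "normal2 p \<bullet> pd e_u (pd e_u klein) p = 0" "normal2 p \<bullet> pd e_v (pd e_v klein) p = 0"
      "pd e_u (pd e_v klein) p \<bullet> normal1 p = 0"
      "normal2 p \<bullet> pd e_u (pd e_v klein) p = 4 * pi\<^sup>2 * r * (s * s + (3/2 + c) * c)"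
      "pd e_u (pd e_u klein) p \<bullet> normal1 p = - pi\<^sup>2 * (s * s + 4 * (3/2 + c) * c)"
      "pd e_v (pd e_v klein) p \<bullet> normal1 p = - 4 * pi\<^sup>2 * (s * s + c * c)"
    unfolding m1 m2 uu uv vv inner_rot by (simp_all add: algebra_simps)
  have fr: "smooth_on2 UNIV normal2" "normal2 q \<bullet> pd e_u klein q = 0" "normal2 q \<bullet> pd e_v klein q = 0"
    "pd e_u klein p \<bullet> normal1 p = 0" "pd e_v klein p \<bullet> normal1 p = 0" for q
    using normal_frame_klein by (simp_all add: normal_frame_def inner_commute[of _ "normal1 p"] del: split_paired_All)
  have "gD klein p \<noteq> 0" using gD_klein_pos[of p] by simp
  note R = R_perp_inner_normal[OF smooth_klein fr(1) open_UNIV UNIV_I fr(2-5) this]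
  have "R_perp klein normal2 p \<bullet> normal1 p =
      (4 * pi\<^sup>2 * (4 * pi\<^sup>2 * r * (s * s + (3/2 + c) * c)) * (- pi\<^sup>2 * (s * s + 4 * (3/2 + c) * c))
       + pi\<^sup>2 * x * (4 * pi\<^sup>2 * r * (s * s + (3/2 + c) * c)) * (4 * pi\<^sup>2 * (s * s + c * c))) / ((2 * pi\<^sup>2)\<^sup>2 * x)"
    unfolding R i gE_klein gF_klein gG_klein gD_klein x_def by simp
  also have "\<dots> = 4 * pi\<^sup>2 * (s * s + (3/2 + c) * c) * (x - (s * s + 4 * (3/2 + c) * c)) * r * (r * r)"
    unfolding sc r(2) using x(1) by (simp add: field_simps power2_eq_square)
  also have "x - (s * s + 4 * (3/2 + c) * c) = 6 * (3/2 + c)"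
    unfolding x(2) by (simp add: algebra_simps)
  also have "s * s + (3/2 + c) * c = (2 + 3 * c) / 2"
    using sc by (simp add: algebra_simps)
  finally show ?thesis
    by (simp add: normal_curv_def c_def r_def x_def power3_eq_cube algebra_simps)
qed

lemma K_perp_klein: "K_perp klein p * sqrt (gD klein p) = normal_curv (snd p)"
  using K_perp_eq[OF smooth_klein _ normal_frame_klein UNIV_I, of p] gD_klein_pos[of p]
  by (simp add: R_perp_klein)

lemma integral_snd_unit_square:
  fixes g :: "real \<Rightarrow> real"
  assumes "continuous_on UNIV g"
  shows "integral (cbox (0, 0) (1, 1)) (\<lambda>p::real \<times> real. g (snd p)) = integral {0..1} g"
proof -
  have "continuous_on A (\<lambda>p::real \<times> real. g (snd p))" for A
    by (rule continuous_on_compose2[OF assms]) (auto intro: continuous_intros)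
  from integral_prod_continuous[OF this, of "0::real" "0::real" 1 1] show ?thesis by simp
qed

text \<open>The normal connection form of the frame is periodic, so its derivative integrates to 0.\<close>
lemma normal_curv_has_integral: "(normal_curv has_integral 0) {0..1}"
proof -
  \<comment> \<open>\<open>?w\<close> is the negative of
    \<open>pd e_u normal2 p \<bullet> normal1 p\<close>. The v-component of the connection form
    vanishes, since \<open>pd e_v normal2\<close> has only imaginary coordinates; so the curvature
    is the v-derivative of \<open>?w\<close>.\<close>
  let ?w = "\<lambda>v. 3 * pi * sin_turn v * inverse (sqrt (radius_sq v))"
  have dX: "(radius_sq has_real_derivative - 2 * pi * sin_turn v * (12 + 6 * cos_turn v)) (at v)" for v
    unfolding radius_sq_def by (auto intro!: derivative_eq_intros simp: algebra_simps)
  have "(?w has_real_derivative normal_curv v) (at v)" for v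
  proof -
    define s c x where "s = sin_turn v" and "c = cos_turn v" and "x = radius_sq v"
    have sc: "s * s + c * c = 1" by (simp add: s_def c_def flip: power2_eq_square)
    have x: "x > 0" "x = 10 + 12 * c + 3 * (c * c)"
      using radius_sq_pos by (simp_all add: x_def radius_sq_def c_def power2_eq_square)
    define q where "q = sqrt x"
    have q: "q > 0" "q * q = x" using x(1) by (simp_all add: q_def)
    have "((\<lambda>v. sqrt (radius_sq v)) has_real_derivative (- 2 * pi * s * (12 + 6 * c)) * (inverse q / 2)) (at v)"
      using radius_sq_pos[of v]
      by (intro DERIV_cong[OF DERIV_chain2[OF DERIV_real_sqrt dX]]) (simp_all add: s_def c_def q_def x_def)
    from DERIV_inverse_fun[OF this]
    have "((\<lambda>v. inverse (sqrt (radius_sq v))) has_real_derivative pi * s * (12 + 6 * c) * (inverse q * inverse q * inverse q)) (at v)"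
      by (rule DERIV_cong) (use q x(1) in \<open>simp_all add: x_def[symmetric] q_def[symmetric] field_simps\<close>)
    from DERIV_mult[OF DERIV_cmult[OF deriv_sin_turn, of "3 * pi"] this]
    have "(?w has_real_derivative 3 * pi * (2 * pi * c) * inverse q
        + pi * s * (12 + 6 * c) * (inverse q * inverse q * inverse q) * (3 * pi * s)) (at v)"
      by (simp add: s_def c_def q_def x_def)
    moreover have "3 * pi * (2 * pi * c) * inverse q
        + pi * s * (12 + 6 * c) * (inverse q * inverse q * inverse q) * (3 * pi * s) =
        6 * pi\<^sup>2 * (c * (q * q) + s * s * (6 + 3 * c)) * (inverse q)^3"
      using q(1) by (simp add: field_simps power2_eq_square power3_eq_cube)
    moreover have "c * (q * q) + s * s * (6 + 3 * c) = 2 * ((3/2 + c) * (2 + 3 * c))"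
      unfolding q x using sc by algebra
    ultimately show ?thesis
      by (simp add: normal_curv_def c_def q_def x_def mult_ac)
  qed
  then have "(normal_curv has_integral (?w 1 - ?w 0)) {0..1}"
    by (intro fundamental_theorem_of_calculus)
      (auto simp: has_real_derivative_iff_has_vector_derivative intro: has_vector_derivative_at_within)
  then show ?thesis by simp
qed

lemma euler_normal_klein: "euler_normal klein = 0"
proof -
  have "elementary (\<lambda>v. 12 * pi\<^sup>2 * ((3/2 + cos_turn v) * (2 + 3 * cos_turn v)) *
      (inverse (sqrt (radius_sq v)) * inverse (sqrt (radius_sq v)) * inverse (sqrt (radius_sq v))))"
    by (intro elementary.mult elementary.add elementary.const elementary_cos_2pi elementary_inverse_radius)
  then have "continuous_on UNIV normal_curv"
    using elementary_continuous by (simp add: normal_curv_def[abs_def] power3_eq_cube)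
  then show ?thesis
    unfolding euler_normal_def K_perp_klein
    using integral_snd_unit_square normal_curv_has_integral by (simp add: integral_unique)
qed

section \<open>The energy estimate\<close>

text \<open>The difference of the two sides has positive coefficients in the Bernstein basis
  (1 + c)^k (1 - c)^(10 - k).\<close>
lemma bernstein_bound:
  fixes c :: real
  assumes "-1 \<le> c" "c \<le> 1"
  shows "100 * (11 + 18 * c + 6 * c\<^sup>2)^4 \<le> (45 + 44 * c + 11 * c\<^sup>2)\<^sup>2 * (10 + 12 * c + 3 * c\<^sup>2)^3"
proof -
  define a b where "a = 1 + c" and "b = 1 - c"
  have ab: "a \<ge> 0" "b \<ge> 0" using assms by (auto simp: a_def b_def)
  have "0 \<le> 44 * b^10 + 11480 * a * b^9 + 132940 * a^2 * b^8 + 1980160 * a^3 * b^7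
      + 17909320 * a^4 * b^6 + 79901456 * a^5 * b^5 + 181536200 * a^6 * b^4
      + 200240000 * a^7 * b^3 + 83087500 * a^8 * b^2 + 3375000 * a^9 * b + 6187500 * a^10"
    using ab by (intro add_nonneg_nonneg mult_nonneg_nonneg zero_le_power) auto
  \<comment> \<open>1024 = 2^10 comes from homogenising the difference, of degree 10, with 1 = (a +
    b)/2 and c = (a - b)/2.\<close>
  also have "\<dots> = 1024 * ((45 + 44 * c + 11 * c\<^sup>2)\<^sup>2 * (10 + 12 * c + 3 * c\<^sup>2)^3
      - 100 * (11 + 18 * c + 6 * c\<^sup>2)^4)"
    unfolding a_def b_def by algebra
  finally have "0 \<le> (45 + 44 * c + 11 * c\<^sup>2)\<^sup>2 * (10 + 12 * c + 3 * c\<^sup>2)^3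
      - 100 * (11 + 18 * c + 6 * c\<^sup>2)^4"
    by (simp only: zero_le_mult_iff) simp
  then show ?thesis by (rule diff_ge_0_iff_ge[THEN iffD1])
qed

text \<open>The quadratic has mean 101/20 over a period, and 101/20 pi < 16 is what the energy bound needs.\<close>
lemma curv_num_bound: "(curv_num v)\<^sup>2 \<le> (9/2 + 22/5 * cos_turn v + 11/10 * (cos_turn v)\<^sup>2) * (radius_sq v * sqrt (radius_sq v))"
\<comment> \<open>Squaring removes the square root; the factor 100 below clears the denominators of
  \<open>?P\<close>.\<close>
proof (rule power2_le_imp_le)
  let ?P = "9/2 + 22/5 * cos_turn v + 11/10 * (cos_turn v)\<^sup>2"
  have P: "?P \<ge> 0"
  proof -
    have "?P = 11/10 * (cos_turn v + 2)\<^sup>2 + 1/10" by (simp add: power2_eq_square algebra_simps)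
    then show ?thesis by simp
  qed
  have "(?P * (radius_sq v * sqrt (radius_sq v)))\<^sup>2 = ?P\<^sup>2 * (radius_sq v)^3"
    using radius_sq_pos[of v] by (simp add: power_mult_distrib power2_eq_square power3_eq_cube)
  moreover have "100 * (?P\<^sup>2 * (radius_sq v)^3) = (45 + 44 * cos_turn v + 11 * (cos_turn v)\<^sup>2)\<^sup>2 * (radius_sq v)^3"
    by algebra
  moreover have "100 * (curv_num v)^4 \<le> (45 + 44 * cos_turn v + 11 * (cos_turn v)\<^sup>2)\<^sup>2 * (radius_sq v)^3"
    unfolding curv_num_def radius_sq_def by (rule bernstein_bound) auto
  moreover have "((curv_num v)\<^sup>2)\<^sup>2 = (curv_num v)^4" by simp
  ultimately show "((curv_num v)\<^sup>2)\<^sup>2 \<le> (?P * (radius_sq v * sqrt (radius_sq v)))\<^sup>2"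
    by linarith
  show "0 \<le> ?P * (radius_sq v * sqrt (radius_sq v))"
    using P radius_sq_pos[of v] by simp
qed

lemma willmore_klein: "willmore klein < 8 * pi"
proof -
  let ?P = "\<lambda>v. 9/2 + (22/5 * cos_turn v + 11/10 * (cos_turn v * cos_turn v))"
  let ?r = "\<lambda>v. inverse (sqrt (radius_sq v))"
  \<comment> \<open>This is Q^2 / X^2 times the area factor 2 pi^2 sqrt X, with powers spelled out
    as products to match the rules of \<open>elementary\<close>.\<close>
  let ?g = "\<lambda>v. 2 * pi\<^sup>2 * (curv_num v * curv_num v * (?r v * ?r v * ?r v))"
  let ?h = "\<lambda>v. 2 * pi\<^sup>2 * ?P v"
  have "elementary (\<lambda>v. 11 + (18 * cos_turn v + 6 * (cos_turn v * cos_turn v)))"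
    by (intro elementary.mult elementary.add elementary.const elementary_cos_2pi)
  then have "elementary curv_num"
    by (simp add: curv_num_def[abs_def] power2_eq_square add.assoc)
  then have "elementary ?g"
    by (intro elementary.mult elementary.const elementary_inverse_radius) assumption
  then have cg: "continuous_on UNIV ?g" by (rule elementary_continuous)
  have "elementary ?h"
    by (intro elementary.mult elementary.add elementary.const elementary_cos_2pi)
  then have ch: "continuous_on UNIV ?h" by (rule elementary_continuous)
  have gh: "?g v \<le> ?h v" for v
  proof -
    define q where "q = sqrt (radius_sq v)"
    have q: "q > 0" "radius_sq v = q * q" using radius_sq_pos[of v] by (simp_all add: q_def)
    have "(curv_num v * curv_num v) \<le> ?P v * (q * q * q)"
      using curv_num_bound[of v, folded q_def, unfolded q(2)] by (simp add: power2_eq_square algebra_simps)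
    then have "curv_num v * curv_num v * (inverse q * inverse q * inverse q) \<le> ?P v"
      using q(1) by (simp add: field_simps)
    then show ?thesis by (simp add: q_def)
  qed
  have "(norm (mean_curv klein p))\<^sup>2 * sqrt (gD klein p) = ?g (snd p)" for p
  proof -
    define q where "q = sqrt (radius_sq (snd p))"
    have q: "q > 0" "radius_sq (snd p) = q * q" using radius_sq_pos[of "snd p"] by (simp_all add: q_def)
    show ?thesis
      unfolding norm_mean_curv_klein sqrt_gD_klein q_def[symmetric] q(2)
      using q(1) by (simp add: field_simps power2_eq_square)
  qed
  then have W: "willmore klein = 1/4 * integral {0..1} ?g"
    unfolding willmore_def by (simp only: integral_snd_unit_square[OF cg])
  have le: "integral {0..1} ?g \<le> integral {0..1} ?h"
    by (intro integral_le gh integrable_continuous_interval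
        continuous_on_subset[OF cg subset_UNIV] continuous_on_subset[OF ch subset_UNIV])
  have h: "integral {0..1} ?h = 2 * pi\<^sup>2 * (9/2 + 11/20)"
  proof -
    \<comment> \<open>The product of sine and cosine integrates the oscillating part of the squared
      cosine; its mean 1/2 is absorbed into the linear term.\<close>
    let ?H = "\<lambda>v. 101/10 * pi\<^sup>2 * v + 22/5 * pi * sin_turn v + 11/20 * pi * (sin_turn v * cos_turn v)"
    have "(?H has_real_derivative ?h v) (at v)" for v
    proof -
      have "(?H has_real_derivative 101/10 * pi\<^sup>2 + 22/5 * pi * (2 * pi * cos_turn v)
          + 11/20 * pi * (2 * pi * cos_turn v * cos_turn v + - 2 * pi * sin_turn v * sin_turn v)) (at v)"
        by (rule DERIV_add[OF DERIV_add[OF DERIV_cmult_Id DERIV_cmult[OF deriv_sin_turn]]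
              DERIV_cmult[OF DERIV_mult[OF deriv_sin_turn deriv_cos_turn]]])
      moreover have "sin_turn v * sin_turn v + cos_turn v * cos_turn v = 1" by (simp flip: power2_eq_square)
      then have "101/10 * pi\<^sup>2 + 22/5 * pi * (2 * pi * cos_turn v)
          + 11/20 * pi * (2 * pi * cos_turn v * cos_turn v + - 2 * pi * sin_turn v * sin_turn v) = ?h v" by algebra
      ultimately show ?thesis by simp
    qed
    then have "(?h has_integral (?H 1 - ?H 0)) {0..1}"
      by (intro fundamental_theorem_of_calculus)
        (auto simp: has_real_derivative_iff_has_vector_derivative intro: has_vector_derivative_at_within)
    from integral_unique[OF this] show ?thesis by simp
  qed
  have "willmore klein \<le> pi * (101/40 * pi)"
    using le unfolding W h by (simp add: power2_eq_square)
  \<comment> \<open>Needs only pi < 320/101, about 3.168.\<close>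
  moreover have "101/40 * pi < 8"
    using pi_approx(2) by simp
  then have "pi * (101/40 * pi) < pi * 8"
    by (rule mult_strict_left_mono) (rule pi_gt_zero)
  ultimately show ?thesis by linarith
qed

section \<open>Embeddedness\<close>

text \<open>A shift of \<open>u\<close> by \<open>m\<close> turns w through full turns and z through
  \<open>m\<close> half turns, hence the sign on the first two coordinates only.\<close>

lemma rot_add_int:
  "rot (u + of_int m) a b c d = rot u ((-1) ^ nat \<bar>m\<bar> * a) ((-1) ^ nat \<bar>m\<bar> * b) c d"
proof -
  have "pi * (u + of_int m) = pi * u + of_int m * pi" "2 * pi * (u + of_int m) = 2 * pi * u + 2 * pi * of_int m"
    by (simp_all add: algebra_simps)
  moreover have "cos (of_int m * pi) = (-1) ^ nat \<bar>m\<bar>"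
    by (cases m rule: int_cases2) simp_all
  moreover have "sin (of_int m * pi) = 0"
    by (simp add: mult.commute[of _ pi])
  moreover have "sin (2 * pi * of_int m) = 0" "cos (2 * pi * of_int m) = 1"
    by simp_all
  ultimately show ?thesis
    unfolding rot_def by (simp add: cos_add sin_add algebra_simps)
qed

text \<open>The height is positive, so it is the modulus of w; equal values of w then give equal
  heights and \<open>u\<close> modulo 1. After undoing that rotation, sine and cosine of the profile
  angle agree up to the parity sign.\<close>

lemma klein_eq_imp:
  assumes "klein p = klein q"
  shows "\<exists>m n :: int. q = (fst p + of_int m, (-1) ^ nat \<bar>m\<bar> * (snd p + of_int n))"
proof -
  obtain u v where p: "p = (u, v)" by force
  obtain u' v' where q: "q = (u', v')" by force
  have eq: "rot u (sin_turn v) 0 (3/2 + cos_turn v) 0 = rot u' (sin_turn v') 0 (3/2 + cos_turn v') 0"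
    using assms by (simp add: klein_def p q)
  let ?y = "3/2 + cos_turn v" and ?y' = "3/2 + cos_turn v'"
  have e: "?y * cos (2 * pi * u) = ?y' * cos (2 * pi * u')" "?y * sin (2 * pi * u) = ?y' * sin (2 * pi * u')"
    using eq by (simp_all add: rot_def vec_eq_iff forall_4)
  have pos: "?y > 0" "?y' > 0"
    using cos_ge_minus_one[of "2 * pi * v"] cos_ge_minus_one[of "2 * pi * v'"] by linarith+
  have "?y\<^sup>2 = (?y * cos (2 * pi * u))\<^sup>2 + (?y * sin (2 * pi * u))\<^sup>2"
    by (simp add: power_mult_distrib flip: distrib_left)
  also have "\<dots> = ?y'\<^sup>2"
    unfolding e by (simp add: power_mult_distrib flip: distrib_left)
  finally have yy: "?y = ?y'" using pos by (simp add: power2_eq_iff_nonneg)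
  then have "sin (2 * pi * u') = sin (2 * pi * u) \<and> cos (2 * pi * u') = cos (2 * pi * u)"
    using e pos by simp
  then obtain m :: int where "2 * pi * u' = 2 * pi * u + 2 * pi * m"
    using sin_cos_eq_iff by blast
  then have m: "u' = u + of_int m"
    by (metis distrib_left mult_cancel_left mult_eq_0_iff pi_neq_zero zero_neq_numeral)
  define \<sigma> :: real where "\<sigma> = (-1) ^ nat \<bar>m\<bar>"
  have \<sigma>: "\<sigma> = 1 \<or> \<sigma> = -1" unfolding \<sigma>_def by (cases "even (nat \<bar>m\<bar>)") auto
  have "rot u (sin_turn v - \<sigma> * sin_turn v') 0 (cos_turn v - cos_turn v') 0 = 0"
    using eq unfolding m rot_add_int \<sigma>_def[symmetric]
    by (simp add: rot_diff[symmetric, of u "sin_turn v" "\<sigma> * sin_turn v'" 0 0 "3/2 + cos_turn v" "3/2 + cos_turn v'" 0 0, simplified])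
  then have "sin_turn v = \<sigma> * sin_turn v'" "cos_turn v = cos_turn v'" by (simp_all add: rot_eq_0_iff)
  \<comment> \<open>The sign moves inside the angle because sine is odd and cosine is even.\<close>
  then have "sin (2 * pi * (\<sigma> * v')) = sin_turn v \<and> cos (2 * pi * (\<sigma> * v')) = cos_turn v"
    using \<sigma> by auto
  then obtain n :: int where "2 * pi * (\<sigma> * v') = 2 * pi * v + 2 * pi * n"
    using sin_cos_eq_iff by blast
  then have n: "\<sigma> * v' = v + of_int n"
    by (metis distrib_left mult_cancel_left mult_eq_0_iff pi_neq_zero zero_neq_numeral)
  have "v' = \<sigma> * (v + of_int n)"
    unfolding n[symmetric] using \<sigma> by auto
  then show ?thesis
    using m unfolding p q \<sigma>_def by auto
qed

lemma klein_embedding_klein: "klein_embedding klein"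
proof -
  have "klein (u + 1, - v) = klein (u, v)" for u v
    using rot_add_int[of u 1] by (simp add: klein_def)
  moreover have "klein (u, v + 1) = klein (u, v)" for u v
    by (simp add: klein_def distrib_left)
  moreover have "pd e_u klein p \<noteq> pd e_v klein p \<and> independent {pd e_u klein p, pd e_v klein p}" for p
  proof -
    have uv: "pd e_u klein p \<bullet> pd e_v klein p = 0" "pd e_u klein p \<noteq> 0" "pd e_v klein p \<noteq> 0"
      using gF_klein[of p] gE_klein[of p] gG_klein[of p] radius_sq_pos[of "snd p"]
      unfolding gE_def gF_def gG_def by auto
    then have "pairwise orthogonal {pd e_u klein p, pd e_v klein p}"
      by (auto simp: pairwise_def orthogonal_def inner_commute)
    then show ?thesis
      using uv by (intro conjI pairwise_orthogonal_independent) auto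
  qed
  ultimately show ?thesis
    unfolding klein_embedding_def using smooth_klein klein_eq_imp by blast
qed

theorem theorem4p1:
  shows "\<exists>f :: real \<times> real \<Rightarrow> real^4.
           klein_embedding f \<and> euler_normal f = 0 \<and> willmore f < 8 * pi"
  using klein_embedding_klein euler_normal_klein willmore_klein by blast

end
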